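(* Let $(\mathcal G_1,e_1)$, $(\mathcal G_2,e_2)$ be rooted graphs with spectral distributions $\mu_1,\mu_2$, let their comb loop product $\mathcal G_1\vartriangleright_\ell\mathcal G_2$ (with root $e$) be naturally colored, and let $A(\mathcal G_1\vartriangleright_\ell\mathcal G_2)=R_1+R_2$ be the decomposition of its adjacency matrix induced by the coloring. Put $Z=R_2R_1$. Then for every $n\in\mathbb N$ $$N_Z(n)=N_{\mu_1\circlearrowright\mu_2}(n)=|D_{2n}(e)|,$$ where $N_Z(n)$ refers to the state $\varphi_e$ and $D_{2n}(e)$ is the set of rooted alternating d-walks of length $2n$ on $\mathcal G_1\vartriangleright_\ell\mathcal G_2$. Moreover, the pair $(R_1-1,R_2-1)$ is monotone independent with respect to $\varphi_e$.
   Context: Graphs are non-oriented, connected, uniformly locally finite (bounded degrees), with a root, possibly with loops and multiple edges. The adjacency matrix of $\mathcal G$ is the operator $A(\mathcal G)\delta(x)=\sum_{x'\sim x}n(x,x')\delta(x')$ on $\ell^2(V)$, $n(x,x')$ being the number of edges joining $x,x'$ (a loop at $x$ contributes $1$ to $n(x,x)$). $\varphi_e(\cdot)=\langle\cdot\,\delta(e),\delta(e)\rangle$; the spectral distribution of $(\mathcal G,e)$ is the distribution of $A(\mathcal G)$ in the state $\varphi_e$. Comb product $\mathcal G_1\vartriangleright\mathcal G_2$: attach a copy of $\mathcal G_2$ by its root to each vertex of $\mathcal G_1$; the root $e$ is the vertex obtained by identifying $e_1$ with $e_2$. Natural coloring: edges of each copy of $\mathcal G_\iota$ get color $\iota\in\{1,2\}$.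 Comb loop product $\mathcal G_1\vartriangleright_\ell\mathcal G_2$: obtained from the naturally colored comb product by attaching a loop of color $1$ to each vertex but the root of each copy of $\mathcal G_2$. $R_\iota$ is the adjacency matrix of the subgraph of edges of color $\iota$. A walk from $v_0$ to $v_n$ is a sequence $(v_0,\beta_1,v_1,\dots,\beta_n,v_n)$, $\beta_i$ an edge joining $v_{i-1}$ and $v_i$; its length is $n$. An f-walk from $v$ to $v$ is a walk with $v_0=v_n=v$ and $v_i\neq v$ for $1\le i\le n-1$. A walk is alternating if the colors of its successive edges alternate. An alternating d-walk from $v$ to $v$ is an alternating walk beginning with an edge of color $1$ which is the concatenation $(u_1,u_2)$ of two f-walks from $v$ to $v$. Rooted means $v=e$. For a unital functional $\mu$ on $\mathbb C[X]$ ($\mu(1)=1$; compactly supported measures are identified with their moment functionals) put $\psi_\mu(z)=\sum_{n\ge1}\mu(X^n)z^n$ and $\eta_\mu=\psi_\mu/(1+\psi_\mu)=\sum_{n\ge1}N_\mu(n)z^n$ (formal power series; $\eta_\mu$ determines $\mu$). For a random variable $Z$ and a state, $N_Z(n)=N_\mu(n)$ with $\mu$ the distribution of $Z$ in that state. Monotone multiplicative convolution: $\eta_{\mu_1\circlearrowright\mu_2}(z)=\eta_{\mu_1}(\eta_{\mu_2}(z))$. A pair $(a,b)$ is monotone independent w.r.t. $\varphi$ if, with $\mathcal A_1,\mathcal A_2$ the non-unital algebras generated by $a$ and by $b$, one has $\varphi(w_1a_1b')=\varphi(b')\varphi(w_1a_1)$, $\varphi(b'a_2w_2)=\varphi(b')\varphi(a_2w_2)$,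 $\varphi(w_1a_1b'a_2w_2)=\varphi(b')\varphi(w_1a_1a_2w_2)$ for all $a_1,a_2\in\mathcal A_1$, $b'\in\mathcal A_2$ and $w_1,w_2$ in the unital algebra generated by $\mathcal A_1,\mathcal A_2$. *)

theory Defs
  imports
    "HOL-Analysis.Analysis"
    "HOL-Library.Function_Algebras"
begin

section \<open>Rooted graphs with loops and multiple edges\<close>

text \<open>
  An edge \<open>b\<close> joins \<open>x\<close> and \<open>y\<close> iff \<open>ends G b = {x, y}\<close>; loops are the edges with a
  singleton set of ends.
\<close>

record ('v, 'e) mgraph =
  verts :: "'v set"
  edges :: "'e set"
  ends :: "'e \<Rightarrow> 'v set"

definition wf_mgraph :: "('v, 'e) mgraph \<Rightarrow> bool" where
  "wf_mgraph G \<longleftrightarrow> (\<forall>b\<in>edges G. \<exists>x\<in>verts G. \<exists>y\<in>verts G. ends G b = {x, y})"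

definition incident :: "('v, 'e) mgraph \<Rightarrow> 'v \<Rightarrow> 'e set" where
  "incident G x = {b \<in> edges G. x \<in> ends G b}"

text \<open>
  Whether a loop counts once or twice in a degree does not affect boundedness.
\<close>

definition uniformly_locally_finite :: "('v, 'e) mgraph \<Rightarrow> bool" where
  "uniformly_locally_finite G \<longleftrightarrow>
     (\<exists>d. \<forall>x\<in>verts G. finite (incident G x) \<and> card (incident G x) \<le> d)"

definition n_edges :: "('v, 'e) mgraph \<Rightarrow> 'v \<Rightarrow> 'v \<Rightarrow> nat" where
  "n_edges G x x' = card {b \<in> edges G. ends G b = {x, x'}}"

definition nbrs :: "('v, 'e) mgraph \<Rightarrow> 'v \<Rightarrow> 'v set" where
  "nbrs G x = {x' \<in> verts G. \<exists>b\<in>edges G. ends G b = {x, x'}}"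

text \<open>
  The walk \<open>(v\<^sub>0, b\<^sub>1, v\<^sub>1, \<dots>, b\<^sub>n, v\<^sub>n)\<close> is the pair of lists
  \<open>([v\<^sub>0, \<dots>, v\<^sub>n], [b\<^sub>1, \<dots>, b\<^sub>n])\<close>; thus \<open>b\<^sub>i\<close> is \<open>bs ! (i - 1)\<close>.
\<close>

type_synonym ('v, 'e) walk = "'v list \<times> 'e list"

fun walk_length :: "('v, 'e) walk \<Rightarrow> nat" where
  "walk_length (vs, bs) = length bs"

fun is_walk :: "('v, 'e) mgraph \<Rightarrow> ('v, 'e) walk \<Rightarrow> bool" where
  "is_walk G (vs, bs) \<longleftrightarrow>
     length vs = length bs + 1 \<and> set vs \<subseteq> verts G \<and> set bs \<subseteq> edges G \<and>
     (\<forall>i<length bs. ends G (bs ! i) = {vs ! i, vs ! (i + 1)})"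

fun walk_from_to :: "('v, 'e) mgraph \<Rightarrow> 'v \<Rightarrow> 'v \<Rightarrow> ('v, 'e) walk \<Rightarrow> bool" where
  "walk_from_to G v v' (vs, bs) \<longleftrightarrow> is_walk G (vs, bs) \<and> hd vs = v \<and> last vs = v'"

definition connected_mgraph :: "('v, 'e) mgraph \<Rightarrow> bool" where
  "connected_mgraph G \<longleftrightarrow> (\<forall>x\<in>verts G. \<forall>y\<in>verts G. \<exists>w. walk_from_to G x y w)"

definition rooted_graph :: "('v, 'e) mgraph \<Rightarrow> 'v \<Rightarrow> bool" where
  "rooted_graph G e \<longleftrightarrow> wf_mgraph G \<and> connected_mgraph G \<and> uniformly_locally_finite G \<and> e \<in> verts G"


section \<open>Alternating d-walks\<close>

text \<open>The trivial walk of length 0 is not an f-walk.\<close>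

fun f_walk :: "('v, 'e) mgraph \<Rightarrow> 'v \<Rightarrow> ('v, 'e) walk \<Rightarrow> bool" where
  "f_walk G v (vs, bs) \<longleftrightarrow>
     walk_from_to G v v (vs, bs) \<and> 1 \<le> length bs \<and> (\<forall>i. 1 \<le> i \<and> i < length bs \<longrightarrow> vs ! i \<noteq> v)"

fun walk_concat :: "('v, 'e) walk \<Rightarrow> ('v, 'e) walk \<Rightarrow> ('v, 'e) walk" where
  "walk_concat (vs, bs) (vs', bs') = (vs @ tl vs', bs @ bs')"

fun alternating :: "('e \<Rightarrow> nat) \<Rightarrow> ('v, 'e) walk \<Rightarrow> bool" where
  "alternating c (vs, bs) \<longleftrightarrow> (\<forall>i. i + 1 < length bs \<longrightarrow> c (bs ! i) \<noteq> c (bs ! (i + 1)))"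

fun begins_with_colour :: "('e \<Rightarrow> nat) \<Rightarrow> nat \<Rightarrow> ('v, 'e) walk \<Rightarrow> bool" where
  "begins_with_colour c i (vs, bs) \<longleftrightarrow> bs \<noteq> [] \<and> c (hd bs) = i"

definition alternating_d_walk ::
    "('v, 'e) mgraph \<Rightarrow> ('e \<Rightarrow> nat) \<Rightarrow> 'v \<Rightarrow> ('v, 'e) walk \<Rightarrow> bool" where
  "alternating_d_walk G c v w \<longleftrightarrow>
     alternating c w \<and> begins_with_colour c 1 w \<and>
     (\<exists>u1 u2. f_walk G v u1 \<and> f_walk G v u2 \<and> w = walk_concat u1 u2)"

definition D_walks :: "('v, 'e) mgraph \<Rightarrow> ('e \<Rightarrow> nat) \<Rightarrow> 'v \<Rightarrow> nat \<Rightarrow> ('v, 'e) walk set" where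
  "D_walks G c v m = {w. alternating_d_walk G c v w \<and> walk_length w = m}"


section \<open>Comb product and comb loop product\<close>

text \<open>
  The copy of the second graph attached at the vertex \<open>x\<close> of the first has vertices \<open>(x, y)\<close>; the
  vertex \<open>x\<close> itself becomes \<open>(x, e2)\<close>. \<open>Base\<close> edges come from the first graph, \<open>Copy x\<close> edges from
  the copy of the second graph at \<open>x\<close>, and \<open>Extra x y\<close> is the loop attached to the non-root vertex
  \<open>(x, y)\<close> of that copy.
\<close>

datatype ('v1, 'e1, 'v2, 'e2) comb_edge = Base 'e1 | Copy 'v1 'e2 | Extra 'v1 'v2

fun comb_ends :: "('v1, 'e1) mgraph \<Rightarrow> ('v2, 'e2) mgraph \<Rightarrow> 'v2 \<Rightarrow>
    ('v1, 'e1, 'v2, 'e2) comb_edge \<Rightarrow> ('v1 \<times> 'v2) set" where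
  "comb_ends G1 G2 e2 (Base b) = (\<lambda>x. (x, e2)) ` ends G1 b"
| "comb_ends G1 G2 e2 (Copy x b) = (\<lambda>y. (x, y)) ` ends G2 b"
| "comb_ends G1 G2 e2 (Extra x y) = {(x, y)}"

definition comb_product :: "('v1, 'e1) mgraph \<Rightarrow> ('v2, 'e2) mgraph \<Rightarrow> 'v2 \<Rightarrow>
    ('v1 \<times> 'v2, ('v1, 'e1, 'v2, 'e2) comb_edge) mgraph" where
  "comb_product G1 G2 e2 =
     \<lparr>verts = verts G1 \<times> verts G2,
      edges = {Base b | b. b \<in> edges G1} \<union> {Copy x b | x b. x \<in> verts G1 \<and> b \<in> edges G2},
      ends = comb_ends G1 G2 e2\<rparr>"

definition comb_loop_product :: "('v1, 'e1) mgraph \<Rightarrow> ('v2, 'e2) mgraph \<Rightarrow> 'v2 \<Rightarrow>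
    ('v1 \<times> 'v2, ('v1, 'e1, 'v2, 'e2) comb_edge) mgraph" where
  "comb_loop_product G1 G2 e2 =
     (comb_product G1 G2 e2)
       \<lparr>edges := edges (comb_product G1 G2 e2) \<union>
          {Extra x y | x y. x \<in> verts G1 \<and> y \<in> verts G2 \<and> y \<noteq> e2}\<rparr>"

fun natural_colour :: "('v1, 'e1, 'v2, 'e2) comb_edge \<Rightarrow> nat" where
  "natural_colour (Base b) = 1"
| "natural_colour (Copy x b) = 2"
| "natural_colour (Extra x y) = 1"

definition colour_subgraph :: "('v, 'e) mgraph \<Rightarrow> ('e \<Rightarrow> nat) \<Rightarrow> nat \<Rightarrow> ('v, 'e) mgraph" where
  "colour_subgraph G c i = G\<lparr>edges := {b \<in> edges G. c b = i}\<rparr>"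


section \<open>Operators on square-summable functions\<close>

definition ell2 :: "'v set \<Rightarrow> ('v \<Rightarrow> complex) set" where
  "ell2 V = {f. (\<forall>x. x \<notin> V \<longrightarrow> f x = 0) \<and> (\<lambda>x. (cmod (f x))\<^sup>2) summable_on V}"

definition ell2_inner :: "'v set \<Rightarrow> ('v \<Rightarrow> complex) \<Rightarrow> ('v \<Rightarrow> complex) \<Rightarrow> complex" where
  "ell2_inner V f g = (\<Sum>\<^sub>\<infinity>x\<in>V. f x * cnj (g x))"

definition delta :: "'v \<Rightarrow> 'v \<Rightarrow> complex" where
  "delta x = (\<lambda>y. if y = x then 1 else 0)"

type_synonym 'v opr = "('v \<Rightarrow> complex) \<Rightarrow> ('v \<Rightarrow> complex)"

text \<open>
  The adjacency matrix has finite rows, so it acts on arbitrary functions; \<open>adjacency_delta\<close> and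
  \<open>adjacency_bounded\<close> below state that it has the prescribed values on the canonical basis and
  restricts to a bounded operator on \<open>ell2 (verts G)\<close>. Sums and differences of operators are the
  pointwise ones, products are compositions, and the unit is \<open>id\<close>.
\<close>

definition adjacency :: "('v, 'e) mgraph \<Rightarrow> 'v opr" where
  "adjacency G f = (\<lambda>x. \<Sum>x'\<in>nbrs G x. of_nat (n_edges G x x') * f x')"

definition opr_scale :: "complex \<Rightarrow> 'v opr \<Rightarrow> 'v opr" where
  "opr_scale c T = (\<lambda>f x. c * T f x)"

definition opr_poly :: "complex poly \<Rightarrow> 'v opr \<Rightarrow> 'v opr" where
  "opr_poly p T = (\<Sum>i\<le>degree p. opr_scale (coeff p i) (T ^^ i))"

definition vec_state :: "'v set \<Rightarrow> 'v \<Rightarrow> 'v opr \<Rightarrow> complex" where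
  "vec_state V e T = ell2_inner V (T (delta e)) (delta e)"

definition opr_distr :: "('v opr \<Rightarrow> complex) \<Rightarrow> 'v opr \<Rightarrow> complex poly \<Rightarrow> complex" where
  "opr_distr \<phi> T p = \<phi> (opr_poly p T)"

definition spectral_distr :: "('v, 'e) mgraph \<Rightarrow> 'v \<Rightarrow> complex poly \<Rightarrow> complex" where
  "spectral_distr G e = opr_distr (vec_state (verts G) e) (adjacency G)"


section \<open>Monotone independence\<close>

inductive_set nonunital_alg :: "'v opr set \<Rightarrow> 'v opr set" for S :: "'v opr set" where
  gen: "a \<in> S \<Longrightarrow> a \<in> nonunital_alg S"
| add: "a \<in> nonunital_alg S \<Longrightarrow> b \<in> nonunital_alg S \<Longrightarrow> a + b \<in> nonunital_alg S"
| scale: "a \<in> nonunital_alg S \<Longrightarrow> opr_scale c a \<in> nonunital_alg S"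
| mult: "a \<in> nonunital_alg S \<Longrightarrow> b \<in> nonunital_alg S \<Longrightarrow> a \<circ> b \<in> nonunital_alg S"

definition unital_alg :: "'v opr set \<Rightarrow> 'v opr set" where
  "unital_alg S = nonunital_alg (insert id S)"

definition monotone_independent :: "('v opr \<Rightarrow> complex) \<Rightarrow> 'v opr \<Rightarrow> 'v opr \<Rightarrow> bool" where
  "monotone_independent \<phi> a b \<longleftrightarrow>
     (let A1 = nonunital_alg {a}; A2 = nonunital_alg {b}; W = unital_alg (A1 \<union> A2) in
       \<forall>a1\<in>A1. \<forall>a2\<in>A1. \<forall>b'\<in>A2. \<forall>w1\<in>W. \<forall>w2\<in>W.
         \<phi> (w1 \<circ> a1 \<circ> b') = \<phi> b' * \<phi> (w1 \<circ> a1) \<and>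
         \<phi> (b' \<circ> a2 \<circ> w2) = \<phi> b' * \<phi> (a2 \<circ> w2) \<and>
         \<phi> (w1 \<circ> a1 \<circ> b' \<circ> a2 \<circ> w2) = \<phi> b' * \<phi> (w1 \<circ> a1 \<circ> a2 \<circ> w2))"


section \<open>Monotone multiplicative convolution\<close>

definition unital_functional :: "(complex poly \<Rightarrow> complex) \<Rightarrow> bool" where
  "unital_functional \<mu> \<longleftrightarrow>
     (\<forall>p q. \<mu> (p + q) = \<mu> p + \<mu> q) \<and> (\<forall>c p. \<mu> (smult c p) = c * \<mu> p) \<and> \<mu> 1 = 1"

definition psi_fps :: "(complex poly \<Rightarrow> complex) \<Rightarrow> complex fps" where
  "psi_fps \<mu> = Abs_fps (\<lambda>n. if n = 0 then 0 else \<mu> (monom 1 n))"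

definition eta_fps :: "(complex poly \<Rightarrow> complex) \<Rightarrow> complex fps" where
  "eta_fps \<mu> = psi_fps \<mu> / (1 + psi_fps \<mu>)"

definition N_coeff :: "(complex poly \<Rightarrow> complex) \<Rightarrow> nat \<Rightarrow> complex" where
  "N_coeff \<mu> n = fps_nth (eta_fps \<mu>) n"

text \<open>\<open>mono_mult_conv_char\<close> below shows that the definite description is well defined.\<close>

definition mono_mult_conv ::
    "(complex poly \<Rightarrow> complex) \<Rightarrow> (complex poly \<Rightarrow> complex) \<Rightarrow> complex poly \<Rightarrow> complex" where
  "mono_mult_conv \<mu>1 \<mu>2 =
     (THE \<mu>. unital_functional \<mu> \<and> eta_fps \<mu> = fps_compose (eta_fps \<mu>1) (eta_fps \<mu>2))"


section \<open>Well-definedness of the notions above\<close>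

lemma fps_mult_inverse_iff:
  fixes a b u v :: "complex fps"
  assumes "v * u = 1"
  shows "a * v = b \<longleftrightarrow> a = b * u"
proof
  assume "a * v = b"
  hence "b * u = a * (v * u)" by (simp add: mult.assoc)
  thus "a = b * u" using assms by simp
next
  assume "a = b * u"
  hence "a * v = b * (v * u)" by (simp add: mult.assoc mult.commute)
  thus "a * v = b" using assms by simp
qed

lemma psi_fps_eq_iff_eta:
  "eta_fps \<mu> = h \<longleftrightarrow> psi_fps \<mu> = h / (1 - h)" if "fps_nth h 0 = 0"
proof -
  define P where "P = psi_fps \<mu>"
  have P0: "fps_nth P 0 = 0" by (simp add: P_def psi_fps_def)
  have u1: "inverse (1 + P) * (1 + P) = 1"
    by (rule inverse_mult_eq_1) (simp add: P0)
  have u2: "inverse (1 - h) * (1 - h) = 1"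
    by (rule inverse_mult_eq_1) (simp add: that)
  have d1: "P / (1 + P) = P * inverse (1 + P)"
    by (rule fps_divide_unit) (simp add: P0)
  have d2: "h / (1 - h) = h * inverse (1 - h)"
    by (rule fps_divide_unit) (simp add: that)
  have "P * inverse (1 + P) = h \<longleftrightarrow> P = h * (1 + P)"
    by (rule fps_mult_inverse_iff[OF u1])
  also have "\<dots> \<longleftrightarrow> P * (1 - h) = h" by (auto simp: algebra_simps)
  also have "\<dots> \<longleftrightarrow> P = h * inverse (1 - h)"
    using fps_mult_inverse_iff[OF u2, of h P] by metis
  finally show ?thesis by (simp add: eta_fps_def d1 d2 flip: P_def)
qed

lemma unital_functional_sum:
  assumes "unital_functional \<mu>"
  shows "\<mu> p = (\<Sum>i\<le>degree p. coeff p i * \<mu> (monom 1 i))"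
proof -
  have add: "\<mu> (p + q) = \<mu> p + \<mu> q" and scale: "\<mu> (smult c p) = c * \<mu> p" for p q c
    using assms by (auto simp: unital_functional_def)
  have "\<mu> 0 = 0" using scale[of 0 0] by simp
  have "\<mu> (\<Sum>i\<in>I. f i) = (\<Sum>i\<in>I. \<mu> (f i))" if "finite I" for I :: "nat set" and f
    using that by (induction I) (auto simp: add \<open>\<mu> 0 = 0\<close>)
  hence "\<mu> (\<Sum>i\<le>degree p. monom (coeff p i) i) = (\<Sum>i\<le>degree p. \<mu> (monom (coeff p i) i))"
    by simp
  also have "\<dots> = (\<Sum>i\<le>degree p. coeff p i * \<mu> (monom 1 i))"
    by (intro sum.cong refl) (simp flip: scale add: smult_monom)
  finally show ?thesis by (simp add: poly_as_sum_of_monoms)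
qed

lemma ex1_functional_with_eta:
  assumes h0: "fps_nth h 0 = 0"
  shows "\<exists>!\<mu>. unital_functional \<mu> \<and> eta_fps \<mu> = h"
proof -
  define m where "m n = (if n = 0 then 1 else fps_nth (h / (1 - h)) n)" for n :: nat
  define \<mu> where "\<mu> p = (\<Sum>i\<le>degree p. coeff p i * m i)" for p :: "complex poly"
  have ext: "\<mu> p = (\<Sum>i\<le>k. coeff p i * m i)" if "degree p \<le> k" for p k
    unfolding \<mu>_def using that by (intro sum.mono_neutral_left) (auto simp: coeff_eq_0)
  have "\<mu> (p + q) = \<mu> p + \<mu> q" for p q
    using ext[of "p + q" "max (degree p) (degree q)"] ext[of p "max (degree p) (degree q)"]
      ext[of q "max (degree p) (degree q)"] degree_add_le_max[of p q]
    by (simp add: sum.distrib algebra_simps)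
  moreover have "\<mu> (smult c p) = c * \<mu> p" for c p
    using ext[of "smult c p" "degree p"]
    by (simp add: \<mu>_def sum_distrib_left algebra_simps degree_smult_le)
  moreover have "\<mu> 1 = 1" by (simp add: \<mu>_def m_def)
  ultimately have unital: "unital_functional \<mu>" by (simp add: unital_functional_def)
  have mom: "\<mu> (monom 1 n) = m n" for n
  proof -
    have "\<mu> (monom 1 n) = (\<Sum>i\<le>n. if i = n then m i else 0)"
      by (subst ext[of _ n]) (simp_all add: degree_monom_le if_distrib[of "\<lambda>c. c * _"] eq_commute cong: if_cong)
    thus ?thesis by simp
  qed
  have h10: "fps_nth (h / (1 - h)) 0 = 0"
    by (subst fps_divide_unit) (auto simp: h0)
  have psi_mu: "psi_fps \<mu> = h / (1 - h)"
    using h10 by (auto simp: fps_eq_iff psi_fps_def mom m_def)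
  show ?thesis
  proof (rule ex1I)
    show "unital_functional \<mu> \<and> eta_fps \<mu> = h"
      using unital psi_mu psi_fps_eq_iff_eta[OF h0] by blast
  next
    fix \<nu> assume nu: "unital_functional \<nu> \<and> eta_fps \<nu> = h"
    hence psi_nu: "psi_fps \<nu> = psi_fps \<mu>" using psi_mu psi_fps_eq_iff_eta[OF h0] by metis
    have mom_eq: "\<nu> (monom 1 n) = \<mu> (monom 1 n)" for n
    proof (cases "n = 0")
      case True
      thus ?thesis using nu unital by (simp add: unital_functional_def)
    next
      case False
      thus ?thesis using arg_cong[OF psi_nu, of "\<lambda>f. fps_nth f n"] by (simp add: psi_fps_def)
    qed
    show "\<nu> = \<mu>"
    proof
      fix p
      have "\<nu> p = (\<Sum>i\<le>degree p. coeff p i * \<nu> (monom 1 i))"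
        using nu by (intro unital_functional_sum) blast
      also have "\<dots> = (\<Sum>i\<le>degree p. coeff p i * \<mu> (monom 1 i))"
        by (simp only: mom_eq)
      also have "\<dots> = \<mu> p"
        by (rule unital_functional_sum[OF unital, symmetric])
      finally show "\<nu> p = \<mu> p" .
    qed
  qed
qed

lemma eta_fps_nth_0: "fps_nth (eta_fps \<mu>) 0 = 0"
  unfolding eta_fps_def by (subst fps_divide_unit) (auto simp: psi_fps_def)

lemma mono_mult_conv_char:
  "unital_functional (mono_mult_conv \<mu>1 \<mu>2)"
  "eta_fps (mono_mult_conv \<mu>1 \<mu>2) = fps_compose (eta_fps \<mu>1) (eta_fps \<mu>2)"
proof -
  have "fps_nth (fps_compose (eta_fps \<mu>1) (eta_fps \<mu>2)) 0 = 0"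
    by (simp add: eta_fps_nth_0)
  from theI'[OF ex1_functional_with_eta[OF this]]
  show "unital_functional (mono_mult_conv \<mu>1 \<mu>2)"
    "eta_fps (mono_mult_conv \<mu>1 \<mu>2) = fps_compose (eta_fps \<mu>1) (eta_fps \<mu>2)"
    unfolding mono_mult_conv_def by auto
qed

lemma nbrs_sym: "x \<in> verts G \<Longrightarrow> x' \<in> nbrs G x \<Longrightarrow> x \<in> nbrs G x'"
  by (auto simp: nbrs_def insert_commute)

lemma nbrs_outside:
  assumes "wf_mgraph G" "z \<notin> verts G"
  shows "nbrs G z = {}"
proof (rule ccontr)
  assume "nbrs G z \<noteq> {}"
  then obtain x' b where b: "b \<in> edges G" "ends G b = {z, x'}" by (auto simp: nbrs_def)
  then obtain x y where "x \<in> verts G" "y \<in> verts G" "ends G b = {x, y}"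
    using assms(1) by (auto simp: wf_mgraph_def)
  thus False using b(2) assms(2) by (auto simp: doubleton_eq_iff)
qed

lemma n_edges_sym: "n_edges G x x' = n_edges G x' x"
  by (simp add: n_edges_def insert_commute)

lemma nbrs_bound:
  assumes "finite (incident G x)"
  shows "finite (nbrs G x)" "card (nbrs G x) \<le> card (incident G x)"
    "n_edges G x x' \<le> card (incident G x)"
proof -
  let ?g = "\<lambda>b. SOME x'. ends G b = {x, x'}"
  have sub: "nbrs G x \<subseteq> ?g ` incident G x"
  proof
    fix x' assume "x' \<in> nbrs G x"
    then obtain b where b: "b \<in> edges G" "ends G b = {x, x'}" by (auto simp: nbrs_def)
    have "ends G b = {x, ?g b}" using b(2) by (rule someI)
    hence "?g b = x'" using b(2) by (auto simp: doubleton_eq_iff)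
    thus "x' \<in> ?g ` incident G x" using b by (force simp: incident_def)
  qed
  show "finite (nbrs G x)" using sub assms finite_surj by blast
  show "card (nbrs G x) \<le> card (incident G x)" using sub assms surj_card_le by blast
  show "n_edges G x x' \<le> card (incident G x)"
    unfolding n_edges_def by (rule card_mono[OF assms]) (auto simp: incident_def)
qed

lemma adjacency_delta:
  assumes "wf_mgraph G" "uniformly_locally_finite G" "x \<in> verts G"
  shows "adjacency G (delta x) = (\<Sum>x'\<in>nbrs G x. opr_scale (of_nat (n_edges G x x')) id (delta x'))"
proof
  fix y
  have sum_apply: "(\<Sum>i\<in>I. F i) y = (\<Sum>i\<in>I. F i y)" if "finite I"
    for I and F :: "'a \<Rightarrow> 'a \<Rightarrow> complex"
    using that by (induction I) auto
  have fin: "finite (nbrs G z)" if "z \<in> verts G" for z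
    using assms(2) that nbrs_bound(1) by (metis uniformly_locally_finite_def)
  have no: "nbrs G z = {}" if "z \<notin> verts G" for z
    using nbrs_outside[OF assms(1) that] .
  have finy: "finite (nbrs G y)" using fin no by (cases "y \<in> verts G") auto
  have mem: "x \<in> nbrs G y \<longleftrightarrow> y \<in> nbrs G x"
    using nbrs_sym[of x G y] nbrs_sym[of y G x] no[of y] assms(3) by (auto simp: nbrs_def)
  have "adjacency G (delta x) y = (\<Sum>x'\<in>nbrs G y. if x' = x then of_nat (n_edges G y x') else 0)"
    by (auto simp: adjacency_def delta_def intro!: sum.cong)
  also have "\<dots> = (if y \<in> nbrs G x then of_nat (n_edges G x y) else 0)"
    using finy mem by (simp add: n_edges_sym)
  also have "\<dots> = (\<Sum>x'\<in>nbrs G x. if x' = y then of_nat (n_edges G x x') else 0)"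
    using fin[OF assms(3)] by simp
  also have "\<dots> = (\<Sum>x'\<in>nbrs G x. opr_scale (of_nat (n_edges G x x')) id (delta x')) y"
    by (subst sum_apply[OF fin[OF assms(3)]])
      (auto simp: opr_scale_def delta_def intro!: sum.cong)
  finally show "adjacency G (delta x) y =
    (\<Sum>x'\<in>nbrs G x. opr_scale (of_nat (n_edges G x x')) id (delta x')) y" .
qed

lemma adjacency_bounded:
  assumes "wf_mgraph G" "uniformly_locally_finite G"
  shows "\<exists>K. \<forall>f\<in>ell2 (verts G). adjacency G f \<in> ell2 (verts G) \<and>
    (\<Sum>\<^sub>\<infinity>x\<in>verts G. (cmod (adjacency G f x))\<^sup>2) \<le> K * (\<Sum>\<^sub>\<infinity>x\<in>verts G. (cmod (f x))\<^sup>2)"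
proof -
  let ?V = "verts G"
  obtain d where d: "\<And>x. x \<in> ?V \<Longrightarrow> finite (incident G x) \<and> card (incident G x) \<le> d"
    using assms(2) by (auto simp: uniformly_locally_finite_def)
  have fin: "finite (nbrs G x)" "card (nbrs G x) \<le> d" "n_edges G x x' \<le> d" if "x \<in> ?V" for x x'
    using nbrs_bound[of G x] d[OF that] by (auto intro: order_trans)
  have no: "nbrs G z = {}" if "z \<notin> ?V" for z
    using nbrs_outside[OF assms(1) that] .
  have main: "adjacency G f \<in> ell2 ?V \<and>
      (\<Sum>\<^sub>\<infinity>x\<in>?V. (cmod (adjacency G f x))\<^sup>2) \<le> real d ^ 4 * (\<Sum>\<^sub>\<infinity>x\<in>?V. (cmod (f x))\<^sup>2)"
    if f: "f \<in> ell2 ?V" for f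
  proof -
    define S where "S = (\<Sum>\<^sub>\<infinity>x\<in>?V. (cmod (f x))\<^sup>2)"
    have summ: "(\<lambda>x. (cmod (f x))\<^sup>2) summable_on ?V" using f by (simp add: ell2_def)
    have row: "(cmod (adjacency G f x))\<^sup>2 \<le> real d ^ 3 * (\<Sum>x'\<in>nbrs G x. (cmod (f x'))\<^sup>2)"
      if x: "x \<in> ?V" for x
    proof -
      have "cmod (adjacency G f x) \<le> (\<Sum>x'\<in>nbrs G x. real (n_edges G x x') * cmod (f x'))"
        unfolding adjacency_def by (rule order_trans[OF norm_sum]) (simp add: norm_mult)
      also have "\<dots> \<le> (\<Sum>x'\<in>nbrs G x. real d * cmod (f x'))"
        using fin(3)[OF x] by (intro sum_mono mult_right_mono) auto
      finally have "(cmod (adjacency G f x))\<^sup>2 \<le> (\<Sum>x'\<in>nbrs G x. real d * cmod (f x'))\<^sup>2"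
        by (intro power_mono) auto
      also have "\<dots> \<le> (\<Sum>x'\<in>nbrs G x. (real d)\<^sup>2) * (\<Sum>x'\<in>nbrs G x. (cmod (f x'))\<^sup>2)"
        by (rule Cauchy_Schwarz_ineq_sum)
      also have "\<dots> \<le> real d ^ 3 * (\<Sum>x'\<in>nbrs G x. (cmod (f x'))\<^sup>2)"
      proof (rule mult_right_mono)
        have "real (card (nbrs G x)) * (real d)\<^sup>2 \<le> real d * (real d)\<^sup>2"
          using fin(2)[OF x] by (intro mult_right_mono) auto
        thus "(\<Sum>x'\<in>nbrs G x. (real d)\<^sup>2) \<le> real d ^ 3"
          by (simp add: power3_eq_cube power2_eq_square)
      qed (auto intro: sum_nonneg)
      finally show ?thesis .
    qed
    have bound: "(\<Sum>x\<in>F. (cmod (adjacency G f x))\<^sup>2) \<le> real d ^ 4 * S"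
      if F: "finite F" "F \<subseteq> ?V" for F
    proof -
      let ?U = "\<Union>x\<in>F. nbrs G x"
      have U: "finite ?U" "?U \<subseteq> ?V" using F fin(1) by (auto simp: nbrs_def)
      have "(\<Sum>x\<in>F. \<Sum>x'\<in>nbrs G x. (cmod (f x'))\<^sup>2)
          = (\<Sum>x\<in>F. \<Sum>x'\<in>?U. if x' \<in> nbrs G x then (cmod (f x'))\<^sup>2 else 0)"
        using U(1) by (intro sum.cong refl sum.mono_neutral_cong_left) auto
      also have "\<dots> = (\<Sum>x'\<in>?U. \<Sum>x\<in>F. if x' \<in> nbrs G x then (cmod (f x'))\<^sup>2 else 0)"
        by (rule sum.swap)
      also have "\<dots> = (\<Sum>x'\<in>?U. real (card {x \<in> F. x' \<in> nbrs G x}) * (cmod (f x'))\<^sup>2)"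
        using F(1) by (intro sum.cong refl) (simp add: sum.inter_filter[symmetric])
      also have "\<dots> \<le> (\<Sum>x'\<in>?U. real d * (cmod (f x'))\<^sup>2)"
      proof (intro sum_mono mult_right_mono)
        fix x' assume "x' \<in> ?U"
        hence x': "x' \<in> ?V" using U by auto
        have "card {x \<in> F. x' \<in> nbrs G x} \<le> card (nbrs G x')"
        proof (rule card_mono[OF fin(1)[OF x']], rule subsetI)
          fix x assume "x \<in> {x \<in> F. x' \<in> nbrs G x}"
          thus "x \<in> nbrs G x'" using F(2) nbrs_sym[of x G x'] by auto
        qed
        thus "real (card {x \<in> F. x' \<in> nbrs G x}) \<le> real d" using fin(2)[OF x'] by simp
      qed auto
      also have "\<dots> \<le> real d * S"
        unfolding S_def sum_distrib_left[symmetric]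
        using U by (intro mult_left_mono finite_sum_le_infsum[OF summ]) auto
      finally have le: "(\<Sum>x\<in>F. \<Sum>x'\<in>nbrs G x. (cmod (f x'))\<^sup>2) \<le> real d * S" .
      have "(\<Sum>x\<in>F. (cmod (adjacency G f x))\<^sup>2) \<le> (\<Sum>x\<in>F. real d ^ 3 * (\<Sum>x'\<in>nbrs G x. (cmod (f x'))\<^sup>2))"
        using F(2) row by (intro sum_mono) auto
      also have "\<dots> \<le> real d ^ 3 * (real d * S)"
        unfolding sum_distrib_left[symmetric] using le by (intro mult_left_mono) auto
      finally show ?thesis by (simp add: power_Suc2 eval_nat_numeral algebra_simps)
    qed
    have summ': "(\<lambda>x. (cmod (adjacency G f x))\<^sup>2) summable_on ?V"
      using bound by (intro nonneg_bdd_above_summable_on) (auto intro!: bdd_aboveI2)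
    have "adjacency G f x = 0" if "x \<notin> ?V" for x
      using no[OF that] by (simp add: adjacency_def)
    thus ?thesis
      using summ' infsum_le_finite_sums[OF summ'] bound by (auto simp: ell2_def S_def)
  qed
  show ?thesis using main by blast
qed

lemma wf_comb_loop_product:
  assumes "wf_mgraph G1" "wf_mgraph G2" "e2 \<in> verts G2"
  shows "wf_mgraph (comb_loop_product G1 G2 e2)"
  unfolding wf_mgraph_def
proof
  let ?G = "comb_loop_product G1 G2 e2"
  fix b assume b: "b \<in> edges ?G"
  show "\<exists>x\<in>verts ?G. \<exists>y\<in>verts ?G. ends ?G b = {x, y}"
  proof (cases b)
    case (Base b1)
    hence "b1 \<in> edges G1" using b by (auto simp: comb_loop_product_def comb_product_def)
    then obtain x y where "x \<in> verts G1" "y \<in> verts G1" "ends G1 b1 = {x, y}"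
      using assms(1) unfolding wf_mgraph_def by blast
    thus ?thesis using Base assms(3)
      by (intro bexI[of _ "(x, e2)"] bexI[of _ "(y, e2)"])
        (simp_all add: comb_loop_product_def comb_product_def)
  next
    case (Copy z b2)
    hence "z \<in> verts G1" "b2 \<in> edges G2"
      using b by (auto simp: comb_loop_product_def comb_product_def)
    moreover from this obtain x y where "x \<in> verts G2" "y \<in> verts G2" "ends G2 b2 = {x, y}"
      using assms(2) unfolding wf_mgraph_def by blast
    ultimately show ?thesis using Copy
      by (intro bexI[of _ "(z, x)"] bexI[of _ "(z, y)"])
        (simp_all add: comb_loop_product_def comb_product_def)
  next
    case (Extra x y)
    thus ?thesis using b
      by (intro bexI[of _ "(x, y)"]) (auto simp: comb_loop_product_def comb_product_def)
  qed
qed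

lemma uniformly_locally_finite_comb_loop_product:
  assumes "wf_mgraph G1" "uniformly_locally_finite G1" "uniformly_locally_finite G2"
  shows "uniformly_locally_finite (comb_loop_product G1 G2 e2)"
proof -
  obtain d1 where d1: "\<And>x. x \<in> verts G1 \<Longrightarrow> finite (incident G1 x) \<and> card (incident G1 x) \<le> d1"
    using assms(2) by (auto simp: uniformly_locally_finite_def)
  obtain d2 where d2: "\<And>x. x \<in> verts G2 \<Longrightarrow> finite (incident G2 x) \<and> card (incident G2 x) \<le> d2"
    using assms(3) by (auto simp: uniformly_locally_finite_def)
  have "finite (incident (comb_loop_product G1 G2 e2) (x, y)) \<and>
      card (incident (comb_loop_product G1 G2 e2) (x, y)) \<le> d1 + d2 + 1"
    if "x \<in> verts G1" "y \<in> verts G2" for x y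
  proof -
    let ?A = "Base ` incident G1 x :: ('a, 'b, 'c, 'd) comb_edge set"
    let ?B = "Copy x ` incident G2 y :: ('a, 'b, 'c, 'd) comb_edge set"
    let ?C = "{Extra x y} :: ('a, 'b, 'c, 'd) comb_edge set"
    have sub: "incident (comb_loop_product G1 G2 e2) (x, y) \<subseteq> ?A \<union> ?B \<union> ?C"
      by (auto simp: incident_def comb_loop_product_def comb_product_def)
    have fin: "finite (?A \<union> ?B \<union> ?C)" using d1 d2 that by auto
    have "card (?A \<union> ?B \<union> ?C) \<le> card ?A + card ?B + card ?C"
      using card_Un_le[of "?A \<union> ?B" ?C] card_Un_le[of ?A ?B] by linarith
    also have "\<dots> \<le> d1 + d2 + 1"
      using d1[OF that(1)] d2[OF that(2)] card_image_le[of "incident G1 x" Base]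
        card_image_le[of "incident G2 y" "Copy x"] by (simp add: add_mono card_image inj_on_def)
    finally show ?thesis using card_mono[OF fin sub] finite_subset[OF sub fin] by linarith
  qed
  thus ?thesis unfolding uniformly_locally_finite_def
    by (auto simp: comb_loop_product_def comb_product_def intro!: exI[of _ "d1 + d2 + 1"])
qed

lemma adjacency_colour_decomposition:
  fixes G1 :: "('v1, 'e1) mgraph" and G2 :: "('v2, 'e2) mgraph"
  assumes "rooted_graph G1 e1" "rooted_graph G2 e2"
  defines "G \<equiv> comb_loop_product G1 G2 e2"
  shows "adjacency G = adjacency (colour_subgraph G natural_colour 1) +
    adjacency (colour_subgraph G natural_colour 2)"
proof (intro ext)
  fix f :: "'v1 \<times> 'v2 \<Rightarrow> complex" and x
  let ?H = "\<lambda>i. colour_subgraph G natural_colour i"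
  have wf: "wf_mgraph G" and ulf: "uniformly_locally_finite G"
    using assms(1,2) unfolding G_def rooted_graph_def
    by (simp_all add: wf_comb_loop_product uniformly_locally_finite_comb_loop_product)
  have fin: "finite (incident G x)" if "nbrs G x \<noteq> {}"
  proof -
    have "x \<in> verts G" using that nbrs_outside[OF wf] by blast
    thus ?thesis using ulf by (auto simp: uniformly_locally_finite_def)
  qed
  have finn: "finite (nbrs G x)" using fin nbrs_bound(1) by fastforce
  have sub: "nbrs (?H i) x \<subseteq> nbrs G x" for i
    by (auto simp: nbrs_def colour_subgraph_def)
  have colr: "natural_colour b = 1 \<or> natural_colour b = 2" for b :: "('v1, 'e1, 'v2, 'e2) comb_edge"
    by (cases b) auto
  have ext: "adjacency (?H i) f x = (\<Sum>x'\<in>nbrs G x. of_nat (n_edges (?H i) x x') * f x')" for i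
    unfolding adjacency_def
  proof (rule sum.mono_neutral_left[OF finn sub], intro ballI)
    fix x' assume "x' \<in> nbrs G x - nbrs (?H i) x"
    hence "{b \<in> edges (?H i). ends (?H i) b = {x, x'}} = {}"
      by (auto simp: nbrs_def colour_subgraph_def)
    thus "of_nat (n_edges (?H i) x x') * f x' = 0" by (simp only: n_edges_def) simp
  qed
  have split: "n_edges G x x' = n_edges (?H 1) x x' + n_edges (?H 2) x x'"
    if "x' \<in> nbrs G x" for x'
  proof -
    have "finite {b \<in> edges G. ends G b = {x, x'}}"
      by (rule finite_subset[OF _ fin]) (use that in \<open>auto simp: incident_def\<close>)
    moreover have "{b \<in> edges G. ends G b = {x, x'}} =
      {b \<in> edges (?H 1). ends (?H 1) b = {x, x'}} \<union> {b \<in> edges (?H 2). ends (?H 2) b = {x, x'}}"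
      using colr by (auto simp: colour_subgraph_def)
    ultimately show ?thesis unfolding n_edges_def
      by (simp only:) (subst card_Un_disjoint, auto simp: colour_subgraph_def)
  qed
  have "adjacency G f x = adjacency (?H 1) f x + adjacency (?H 2) f x"
    unfolding ext sum.distrib[symmetric] unfolding adjacency_def
    by (intro sum.cong refl) (simp add: split algebra_simps)
  thus "adjacency G f x = (adjacency (?H 1) + adjacency (?H 2)) f x" by simp
qed

end

theory Submission
  imports Defs
begin

text \<open>
  For a linear operator \<open>T\<close> the coefficients \<open>N\<^sub>T(n + 1)\<close> are the first-return weights
  \<open>\<langle>T (Q T)\<^sup>n \<delta>(e), \<delta>(e)\<rangle>\<close>, where \<open>Q\<close> projects away from \<open>\<delta>(e)\<close>. On the comb loop product,
  \<open>R\<^sub>1 = A\<^sub>1 \<otimes> P + 1 \<otimes> (1 - P)\<close> and \<open>R\<^sub>2 = 1 \<otimes> A\<^sub>2\<close> with \<open>P\<close> the projection onto \<open>\<delta>(e\<^sub>2)\<close>, which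
  yields the generating function of the vectors \<open>(Q Z)\<^sup>n \<delta>(e)\<close> in closed form, and monotone
  independence from \<open>R\<^sub>1 - 1 = (A\<^sub>1 - 1) \<otimes> P\<close> and \<open>R\<^sub>2 - 1 = 1 \<otimes> (A\<^sub>2 - 1)\<close>. Combinatorially, the first-return
  weights of \<open>Z\<close> count the alternating walks that avoid \<open>e\<close> at inner even times, and such a closed
  walk passes through \<open>e\<close> at exactly one odd time.
\<close>

section \<open>First-passage vectors\<close>

text \<open>This is (Q T)^n applied to \<open>delta e\<close>. The reset follows each application of
  \<open>T\<close>, so at index 0 the entry 1 at \<open>e\<close> survives.\<close>

definition passage :: "'v opr \<Rightarrow> 'v \<Rightarrow> nat \<Rightarrow> 'v \<Rightarrow> complex" where
  "passage T e n = ((\<lambda>f. (T f)(e := 0)) ^^ n) (delta e)"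

lemma passage_0: "passage T e 0 = delta e"
  by (simp add: passage_def)

lemma passage_Suc: "passage T e (Suc n) = (T (passage T e n))(e := 0)"
  by (simp add: passage_def)

lemma passage_Suc_root: "passage T e (Suc n) e = 0"
  by (simp add: passage_Suc)

definition linear_opr :: "'v opr \<Rightarrow> bool" where
  "linear_opr T \<longleftrightarrow> (\<forall>f g. T (f + g) = T f + T g) \<and> (\<forall>c f. T (\<lambda>x. c * f x) = (\<lambda>x. c * T f x))"

lemma linear_opr_sum:
  assumes "linear_opr T"
  shows "T (\<lambda>x. \<Sum>i<n. c i * f i x) = (\<lambda>x. \<Sum>i<(n::nat). c i * T (f i) x)"
proof (induction n)
  case 0
  have "T (\<lambda>x. 0 * (0::complex)) = (\<lambda>x. 0 * T (\<lambda>_. 0) x)"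
    using assms[unfolded linear_opr_def, THEN conjunct2, rule_format, of 0 "\<lambda>_. 0"] by simp
  thus ?case by simp
next
  case (Suc n)
  have "T (\<lambda>x. \<Sum>i<Suc n. c i * f i x) = T ((\<lambda>x. \<Sum>i<n. c i * f i x) + (\<lambda>x. c n * f n x))"
    by (simp add: plus_fun_def)
  also have "\<dots> = T (\<lambda>x. \<Sum>i<n. c i * f i x) + (\<lambda>x. c n * T (f n) x)"
    using assms unfolding linear_opr_def by simp
  finally show ?case by (simp add: Suc plus_fun_def)
qed

lemma linear_opr_comp:
  assumes "linear_opr S" "linear_opr T"
  shows "linear_opr (S \<circ> T)"
  using assms by (simp add: linear_opr_def)

lemma linear_opr_adjacency: "linear_opr (adjacency G)"
  by (auto simp: linear_opr_def adjacency_def plus_fun_def sum.distrib sum_distrib_left algebra_simps)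

text \<open>Renewal decomposition: summand \<open>k\<close> collects the contributions whose first
  return takes \<open>k + 1\<close> steps, the passage vector those that have not yet
  returned.\<close>

lemma funpow_delta_passage:
  assumes "linear_opr T"
  shows "(T ^^ n) (delta e) = passage T e n +
    (\<lambda>x. \<Sum>k<n. T (passage T e k) e * (T ^^ (n - Suc k)) (delta e) x)"
proof (induction n)
  case 0
  show ?case by (simp add: passage_0 plus_fun_def)
next
  case (Suc n)
  let ?c = "\<lambda>k. T (passage T e k) e"
  have "(T ^^ Suc n) (delta e) = T (passage T e n) +
      T (\<lambda>x. \<Sum>k<n. ?c k * (T ^^ (n - Suc k)) (delta e) x)"
    using assms by (simp only: funpow.simps o_apply Suc linear_opr_def)
  also have "\<dots> = T (passage T e n) + (\<lambda>x. \<Sum>k<n. ?c k * (T ^^ Suc (n - Suc k)) (delta e) x)"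
    by (simp add: linear_opr_sum[OF assms])
  also have "\<dots> = T (passage T e n) + (\<lambda>x. \<Sum>k<n. ?c k * (T ^^ (n - k)) (delta e) x)"
    by (simp add: Suc_diff_Suc del: funpow.simps cong: sum.cong_simp)
  \<comment> \<open>The entry erased by the reset becomes the summand \<open>k = n\<close>, whose
    remaining power of \<open>T\<close> is the identity.\<close>
  also have "T (passage T e n) = passage T e (Suc n) + (\<lambda>x. ?c n * delta e x)"
    by (auto simp: passage_Suc delta_def)
  finally show ?case by (simp add: plus_fun_def algebra_simps)
qed

section \<open>First returns and the transform eta\<close>

lemma vec_state_eq:
  assumes "e \<in> V"
  shows "vec_state V e T = T (delta e) e"
proof -
  have "vec_state V e T = (\<Sum>\<^sub>\<infinity>x\<in>{e}. T (delta e) x * cnj (delta e x))"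
    unfolding vec_state_def ell2_inner_def
    by (rule infsum_cong_neutral) (use assms in \<open>auto simp: delta_def\<close>)
  thus ?thesis by (simp add: delta_def)
qed

lemma opr_poly_monom: "opr_poly (monom 1 n) T = T ^^ n"
proof -
  have "opr_poly (monom 1 n) T = (\<Sum>i\<le>n. if i = n then T ^^ n else 0)"
    unfolding opr_poly_def
    by (intro sum.cong) (auto simp: degree_monom_eq opr_scale_def fun_eq_iff)
  thus ?thesis by simp
qed

text \<open>
  The power series \<open>\<eta>\<close> enumerates first returns, because cutting a return at its first return
  gives \<open>\<psi> = \<eta> (1 + \<psi>)\<close>.
\<close>

lemma eta_fps_eq_passage:
  assumes T: "linear_opr T" and "e \<in> V"
  shows "eta_fps (opr_distr (vec_state V e) T) =
    fps_X * Abs_fps (\<lambda>n. T (passage T e n) e)"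
proof -
  define \<mu> where "\<mu> = opr_distr (vec_state V e) T"
  define C where "C = Abs_fps (\<lambda>n. T (passage T e n) e)"
  define M where "M = Abs_fps (\<lambda>n. (T ^^ n) (delta e) e)"
  have mom: "\<mu> (monom 1 n) = (T ^^ n) (delta e) e" for n
    by (simp add: \<mu>_def opr_distr_def opr_poly_monom vec_state_eq[OF assms(2)])
  have M: "1 + psi_fps \<mu> = M"
    by (rule fps_ext) (auto simp: psi_fps_def M_def mom delta_def)
  have "psi_fps \<mu> = fps_X * (C * M)"
  proof (rule fps_ext)
    fix n show "fps_nth (psi_fps \<mu>) n = fps_nth (fps_X * (C * M)) n"
    proof (cases n)
      case 0
      thus ?thesis by (simp add: psi_fps_def)
    next
      case (Suc m)
      \<comment> \<open>At a positive index the passage vector vanishes at \<open>e\<close>, which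
        leaves a pure convolution.\<close>
      have "(T ^^ Suc m) (delta e) e =
          (\<Sum>k<Suc m. T (passage T e k) e * (T ^^ (Suc m - Suc k)) (delta e) e)"
        by (subst funpow_delta_passage[OF T]) (simp add: passage_Suc_root del: sum.lessThan_Suc)
      also have "\<dots> = fps_nth (C * M) m"
        by (simp only: fps_mult_nth C_def M_def fps_nth_Abs_fps atLeast0AtMost lessThan_Suc_atMost
            diff_Suc_Suc)
      finally show ?thesis by (simp add: Suc psi_fps_def mom del: funpow.simps)
    qed
  qed
  hence psi: "psi_fps \<mu> = (fps_X * C) * (1 + psi_fps \<mu>)"
    unfolding M mult.assoc .
  have u: "inverse (1 + psi_fps \<mu>) * (1 + psi_fps \<mu>) = 1"
    by (rule inverse_mult_eq_1) (simp add: psi_fps_def)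
  have "eta_fps \<mu> = psi_fps \<mu> * inverse (1 + psi_fps \<mu>)"
    unfolding eta_fps_def by (rule fps_divide_unit) (simp add: psi_fps_def)
  also have "\<dots> = fps_X * C"
    using fps_mult_inverse_iff[OF u] psi by blast
  finally show ?thesis by (simp add: \<mu>_def C_def)
qed

section \<open>Adjacency operators with general coefficients\<close>

text \<open>Arbitrary coefficients allow vectors with entries in \<open>\<complex>[[z]]\<close>.\<close>

definition adj :: "('v, 'e) mgraph \<Rightarrow> ('v \<Rightarrow> 'a::comm_semiring_1) \<Rightarrow> 'v \<Rightarrow> 'a" where
  "adj G f x = (\<Sum>x'\<in>nbrs G x. of_nat (n_edges G x x') * f x')"

lemma adjacency_eq_adj: "adjacency G f = adj G f"
  by (simp add: adjacency_def adj_def fun_eq_iff)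

lemma adj_outside: "wf_mgraph G \<Longrightarrow> x \<notin> verts G \<Longrightarrow> adj G f x = 0"
  by (simp add: adj_def nbrs_outside)

lemma adj_mult_left: "adj G (\<lambda>x. c * f x) x = c * adj G f x"
  by (simp add: adj_def sum_distrib_left algebra_simps)

lemma fps_nth_adj: "fps_nth (adj G F x) n = adj G (\<lambda>x. fps_nth (F x) n) x"
  by (simp add: adj_def fps_sum_nth fps_of_nat[symmetric])

text \<open>Substituting a series without constant term is a ring homomorphism fixing constants, and
  the weights of the row sums are constants.\<close>

lemma adj_fps_compose:
  fixes F :: "'v \<Rightarrow> complex fps"
  assumes "fps_nth h 0 = 0"
  shows "adj G (\<lambda>x. F x oo h) x = adj G F x oo h"
  using assms by (simp add: adj_def fps_compose_sum_distrib fps_compose_mult_distrib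
      fps_of_nat[symmetric])

text \<open>Summing the passage recursion over powers of z gives a linear system for
  \<open>h\<close> whose row at \<open>e\<close> is replaced by the normalisation 1; the row so
  discarded is the first-return series.\<close>

lemma eta_fps_adjacency:
  fixes e :: 'v
  assumes "e \<in> verts G"
    and h: "\<And>x n. fps_nth (h x) n = passage (adjacency G) e n x"
  shows "h x = (if x = e then 1 else fps_X * adj G h x)"
    and "eta_fps (spectral_distr G e) = fps_X * adj G h e"
proof -
  have nth: "fps_nth (adj G h x) n = adjacency G (passage (adjacency G) e n) x" for x n
    by (simp add: fps_nth_adj h adjacency_eq_adj)
  show "h x = (if x = e then 1 else fps_X * adj G h x)"
  proof (rule fps_ext)
    fix n show "fps_nth (h x) n = fps_nth (if x = e then 1 else fps_X * adj G h x) n"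
      by (cases n) (auto simp: nth h passage_0 passage_Suc delta_def)
  qed
  show "eta_fps (spectral_distr G e) = fps_X * adj G h e"
    unfolding spectral_distr_def eta_fps_eq_passage[OF linear_opr_adjacency assms(1)]
    by (rule arg_cong[of _ _ "(*) fps_X"]) (simp add: fps_eq_iff nth)
qed

lemma wf_colour_subgraph: "wf_mgraph G \<Longrightarrow> wf_mgraph (colour_subgraph G c i)"
  by (simp add: wf_mgraph_def colour_subgraph_def)

section \<open>Counting alternating walks\<close>

text \<open>
  For \<open>m = 2 n\<close> these are the walks counted by \<open>Z (Q Z)\<^sup>n\<^sup>-\<^sup>1 \<delta>(e)\<close>: visits of \<open>e\<close> at odd times are allowed.
\<close>

definition alt_walks ::
    "('v, 'e) mgraph \<Rightarrow> ('e \<Rightarrow> nat) \<Rightarrow> 'v \<Rightarrow> nat \<Rightarrow> 'v \<Rightarrow> ('v, 'e) walk set" where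
  "alt_walks G c e m v = {(vs, bs). length vs = Suc m \<and> length bs = m \<and>
     set vs \<subseteq> verts G \<and> set bs \<subseteq> edges G \<and> vs ! 0 = e \<and> vs ! m = v \<and>
     (\<forall>i<m. ends G (bs ! i) = {vs ! i, vs ! Suc i} \<and> c (bs ! i) = (if even i then 1 else 2) \<and>
        (0 < i \<and> even i \<longrightarrow> vs ! i \<noteq> e))}"

lemma alt_walks_0: "e \<in> verts G \<Longrightarrow> alt_walks G c e 0 v = (if v = e then {([e], [])} else {})"
  by (auto simp: alt_walks_def length_Suc_conv)

text \<open>Avoidance is imposed where an edge starts, so appending a step tests the old endpoint
  \<open>vs ! m\<close> and leaves the new one free. Edges are numbered from 0, hence colour 1 at
  even indices.\<close>

lemma alt_walks_snoc_iff:
  "(vs @ [w], bs @ [b]) \<in> alt_walks G c e (Suc m) v \<longleftrightarrow>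
     w = v \<and> v \<in> verts G \<and> (vs, bs) \<in> alt_walks G c e m (vs ! m) \<and>
     b \<in> edges G \<and> ends G b = {v, vs ! m} \<and> c b = (if even m then 1 else 2) \<and>
     (0 < m \<and> even m \<longrightarrow> vs ! m \<noteq> e)"
proof (cases "length vs = Suc m \<and> length bs = m")
  case True
  define ok where "ok vs bs i \<longleftrightarrow> ends G (bs ! i) = {vs ! i, vs ! Suc i} \<and>
    c (bs ! i) = (if even i then 1 else 2) \<and> (0 < i \<and> even i \<longrightarrow> vs ! i \<noteq> e)" for vs bs i
  have vs: "(vs @ [w]) ! i = vs ! i" if "i \<le> m" for i
    using True that by (simp add: nth_append)
  have last: "(vs @ [w]) ! Suc m = w" "(bs @ [b]) ! m = b"
    using True by (metis nth_append_length)+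
  have "(\<forall>i<Suc m. ok (vs @ [w]) (bs @ [b]) i) \<longleftrightarrow>
      ok (vs @ [w]) (bs @ [b]) m \<and> (\<forall>i<m. ok vs bs i)"
    unfolding All_less_Suc using True by (auto simp: ok_def vs nth_append)
  moreover have "ok (vs @ [w]) (bs @ [b]) m \<longleftrightarrow> ends G b = {vs ! m, w} \<and>
      c b = (if even m then 1 else 2) \<and> (0 < m \<and> even m \<longrightarrow> vs ! m \<noteq> e)"
    by (simp only: ok_def vs last order_refl)
  ultimately show ?thesis
    using True unfolding alt_walks_def ok_def[symmetric]
    by (auto simp: vs last insert_commute)
next
  case False
  thus ?thesis by (auto simp: alt_walks_def)
qed

lemma alt_walks_Suc:
  fixes G :: "('v, 'e) mgraph" and c :: "'e \<Rightarrow> nat"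
  assumes "v \<in> verts G"
  defines "H \<equiv> \<lambda>m. colour_subgraph G c (if even m then 1 else 2)"
  shows "alt_walks G c e (Suc m) v =
    (\<Union>v'\<in>{v' \<in> nbrs (H m) v. \<not> (0 < m \<and> even m \<and> v' = e)}.
      (\<lambda>((vs, bs), b). (vs @ [v], bs @ [b])) `
        (alt_walks G c e m v' \<times> {b \<in> edges (H m). ends (H m) b = {v, v'}}))"
proof (intro equalityI subsetI)
  fix w assume w: "w \<in> alt_walks G c e (Suc m) v"
  obtain vs u bs b where w_eq: "w = (vs @ [u], bs @ [b])"
  proof -
    obtain vs' bs' where "w = (vs', bs')" by (cases w)
    moreover from this have "vs' \<noteq> []" "bs' \<noteq> []" using w by (auto simp: alt_walks_def)
    ultimately show ?thesis using that by (metis append_butlast_last_id)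
  qed
  from w have *: "u = v" "(vs, bs) \<in> alt_walks G c e m (vs ! m)" "b \<in> edges G"
    "ends G b = {v, vs ! m}" "c b = (if even m then 1 else 2)" "0 < m \<and> even m \<longrightarrow> vs ! m \<noteq> e"
    unfolding w_eq alt_walks_snoc_iff by auto
  from *(2) have "vs ! m \<in> verts G" by (auto simp: alt_walks_def)
  hence "vs ! m \<in> {v' \<in> nbrs (H m) v. \<not> (0 < m \<and> even m \<and> v' = e)}"
    and "b \<in> {b \<in> edges (H m). ends (H m) b = {v, vs ! m}}"
    using * by (auto simp: nbrs_def H_def colour_subgraph_def)
  thus "w \<in> (\<Union>v'\<in>{v' \<in> nbrs (H m) v. \<not> (0 < m \<and> even m \<and> v' = e)}.
      (\<lambda>((vs, bs), b). (vs @ [v], bs @ [b])) `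
        (alt_walks G c e m v' \<times> {b \<in> edges (H m). ends (H m) b = {v, v'}}))"
    using *(1,2) w_eq by force
next
  fix w assume "w \<in> (\<Union>v'\<in>{v' \<in> nbrs (H m) v. \<not> (0 < m \<and> even m \<and> v' = e)}.
      (\<lambda>((vs, bs), b). (vs @ [v], bs @ [b])) `
        (alt_walks G c e m v' \<times> {b \<in> edges (H m). ends (H m) b = {v, v'}}))"
  then obtain v' vs bs b where *: "\<not> (0 < m \<and> even m \<and> v' = e)" "w = (vs @ [v], bs @ [b])"
    "(vs, bs) \<in> alt_walks G c e m v'" "b \<in> edges (H m)" "ends (H m) b = {v, v'}"
    by auto
  moreover have "vs ! m = v'" using *(3) by (simp add: alt_walks_def)
  ultimately show "w \<in> alt_walks G c e (Suc m) v"
    using assms(1) by (auto simp: alt_walks_snoc_iff H_def colour_subgraph_def)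
qed

lemma alt_walks_last: "(vs, bs) \<in> alt_walks G c e m v \<Longrightarrow> vs ! m = v"
  by (simp add: alt_walks_def)

lemma alt_walks_outside:
  assumes "v \<notin> verts G"
  shows "alt_walks G c e m v = {}"
proof -
  have "v \<in> verts G" if "(vs, bs) \<in> alt_walks G c e m v" for vs bs
    using that nth_mem[of m vs] unfolding alt_walks_def by auto
  thus ?thesis using assms by auto
qed

lemma finite_joins:
  assumes "uniformly_locally_finite G" "v \<in> verts G"
  shows "finite (nbrs (colour_subgraph G c i) v)"
    and "finite {b \<in> edges (colour_subgraph G c i). ends (colour_subgraph G c i) b = {v, v'}}"
proof -
  have fin: "finite (incident G v)"
    using assms by (auto simp: uniformly_locally_finite_def)
  show "finite (nbrs (colour_subgraph G c i) v)"
    by (rule finite_subset[OF _ nbrs_bound(1)[OF fin]])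
      (auto simp: nbrs_def colour_subgraph_def)
  show "finite {b \<in> edges (colour_subgraph G c i). ends (colour_subgraph G c i) b = {v, v'}}"
    by (rule finite_subset[OF _ fin]) (auto simp: incident_def colour_subgraph_def)
qed

lemma finite_alt_walks:
  assumes "uniformly_locally_finite G" "e \<in> verts G"
  shows "finite (alt_walks G c e m v)"
proof (induction m arbitrary: v)
  case 0
  show ?case by (simp add: alt_walks_0 assms)
next
  case (Suc m)
  show ?case
  proof (cases "v \<in> verts G")
    case True
    show ?thesis
      unfolding alt_walks_Suc[OF True]
      by (intro finite_UN_I finite_imageI finite_cartesian_product Suc finite_joins(2))
        (use assms True finite_joins(1)[OF assms(1) True] in auto)
  qed (simp add: alt_walks_outside)
qed

text \<open>Splitting by penultimate vertex and last edge is disjoint, and the number of parallel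
  edges is the matrix entry. Forbidding \<open>e\<close> at positive even times becomes the
  projection Q.\<close>

lemma card_alt_walks_Suc:
  assumes "wf_mgraph G" "uniformly_locally_finite G" "e \<in> verts G"
  shows "of_nat (card (alt_walks G c e (Suc m) v)) =
    adjacency (colour_subgraph G c (if even m then 1 else 2))
      (\<lambda>v'. if 0 < m \<and> even m \<and> v' = e then 0 else of_nat (card (alt_walks G c e m v'))) v"
proof (cases "v \<in> verts G")
  case True
  let ?H = "colour_subgraph G c (if even m then 1 else 2)"
  let ?E = "\<lambda>v'. {b \<in> edges ?H. ends ?H b = {v, v'}}"
  let ?N = "{v' \<in> nbrs ?H v. \<not> (0 < m \<and> even m \<and> v' = e)}"
  let ?f = "\<lambda>((vs, bs), b). (vs @ [v], bs @ [b])"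
  have finN: "finite (nbrs ?H v)" and finE: "\<And>v'. finite (?E v')"
    using finite_joins[OF assms(2) True] by auto
  have "card (alt_walks G c e (Suc m) v) =
      (\<Sum>v'\<in>?N. card (?f ` (alt_walks G c e m v' \<times> ?E v')))"
    unfolding alt_walks_Suc[OF True]
  proof (rule card_UN_disjoint)
    show "finite ?N" using finN by simp
    show "\<forall>v'\<in>?N. finite (?f ` (alt_walks G c e m v' \<times> ?E v'))"
      using finite_alt_walks[OF assms(2,3)] finE by blast
    show "\<forall>v'\<in>?N. \<forall>v''\<in>?N. v' \<noteq> v'' \<longrightarrow>
        ?f ` (alt_walks G c e m v' \<times> ?E v') \<inter> ?f ` (alt_walks G c e m v'' \<times> ?E v'') = {}"
      by (auto dest!: alt_walks_last)
  qed
  also have "\<dots> = (\<Sum>v'\<in>?N. card (alt_walks G c e m v') * n_edges ?H v v')"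
  proof (rule sum.cong[OF refl])
    fix v'
    have "inj_on ?f (alt_walks G c e m v' \<times> ?E v')" by (rule inj_onI) (auto split: prod.splits)
    thus "card (?f ` (alt_walks G c e m v' \<times> ?E v')) = card (alt_walks G c e m v') * n_edges ?H v v'"
      by (simp only: card_image card_cartesian_product n_edges_def)
  qed
  finally have "of_nat (card (alt_walks G c e (Suc m) v)) =
      (\<Sum>v'\<in>?N. of_nat (n_edges ?H v v') * (of_nat (card (alt_walks G c e m v')) :: complex))"
    by (simp add: mult.commute)
  also have "\<dots> = adjacency ?H
      (\<lambda>v'. if 0 < m \<and> even m \<and> v' = e then 0 else of_nat (card (alt_walks G c e m v'))) v"
    unfolding adjacency_def using finN by (intro sum.mono_neutral_cong_left) auto
  finally show ?thesis .
next
  case False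
  thus ?thesis
    using nbrs_outside[OF wf_colour_subgraph[OF assms(1)], of v c]
    by (simp add: alt_walks_outside adjacency_def colour_subgraph_def)
qed

text \<open>A colour 1 step followed by a colour 2 step is one application of \<open>Z\<close>. The
  last application is not followed by a reset, whence \<open>2 * Suc n\<close> steps against passage
  index \<open>n\<close>.\<close>

lemma card_alt_walks_even:
  fixes G :: "('v, 'e) mgraph" and c :: "'e \<Rightarrow> nat"
  assumes "wf_mgraph G" "uniformly_locally_finite G" "e \<in> verts G"
  defines "Z \<equiv> adjacency (colour_subgraph G c 2) \<circ> adjacency (colour_subgraph G c 1)"
  shows "of_nat (card (alt_walks G c e (2 * Suc n) v)) = Z (passage Z e n) v"
proof -
  \<comment> \<open>The counts with the entry at \<open>e\<close> erased, except at time 0, where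
    the walk starts there.\<close>
  define q where "q n = (\<lambda>v. if 0 < n \<and> v = e then 0 else
    of_nat (card (alt_walks G c e (2 * n) v)) :: complex)" for n
  have step: "of_nat (card (alt_walks G c e (2 * Suc n) v)) = Z (q n) v" for n v
  proof -
    have "(\<lambda>v. of_nat (card (alt_walks G c e (Suc (2 * n)) v))) =
        adjacency (colour_subgraph G c 1) (q n)"
      by (rule ext, subst card_alt_walks_Suc[OF assms(1-3)]) (simp add: q_def)
    moreover have "of_nat (card (alt_walks G c e (Suc (Suc (2 * n))) v)) =
        adjacency (colour_subgraph G c 2) (\<lambda>v. of_nat (card (alt_walks G c e (Suc (2 * n)) v))) v"
      by (subst card_alt_walks_Suc[OF assms(1-3)]) simp
    ultimately show ?thesis by (simp add: Z_def)
  qed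
  have "q n = passage Z e n"
  proof (induction n)
    case 0
    show ?case by (auto simp: q_def alt_walks_0 assms(3) passage_0 delta_def)
  next
    case (Suc n)
    have "q (Suc n) = (\<lambda>v. if v = e then 0 else Z (q n) v)"
      unfolding step[symmetric] q_def[of "Suc n"] by simp
    thus ?case by (auto simp: Suc passage_Suc)
  qed
  thus ?thesis using step by simp
qed

section \<open>Alternating d-walks as walks avoiding the root at inner even times\<close>

text \<open>The junction of the two f-walks is the only inner visit of \<open>v\<close>; conversely,
  a closed walk with a single inner visit is cut there.\<close>

lemma f_walk_concat_iff:
  "(\<exists>u1 u2. f_walk G v u1 \<and> f_walk G v u2 \<and> (vs, bs) = walk_concat u1 u2) \<longleftrightarrow>
     is_walk G (vs, bs) \<and> vs ! 0 = v \<and> vs ! length bs = v \<and>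
     (\<exists>k. 0 < k \<and> k < length bs \<and> (\<forall>i. 0 < i \<and> i < length bs \<longrightarrow> (vs ! i = v \<longleftrightarrow> i = k)))"
  (is "?L \<longleftrightarrow> ?R")
proof
  assume ?L
  then obtain vs1 bs1 vs2 bs2 where u: "f_walk G v (vs1, bs1)" "f_walk G v (vs2, bs2)"
    and eq: "vs = vs1 @ tl vs2" "bs = bs1 @ bs2"
    by auto
  have ne: "vs1 \<noteq> []" "vs2 \<noteq> []" using u by auto
  have len: "length vs1 = Suc (length bs1)" "length vs2 = Suc (length bs2)" using u by auto
  have ends1: "vs1 ! 0 = v" "vs1 ! length bs1 = v" "vs2 ! 0 = v" "vs2 ! length bs2 = v"
    using u ne len by (auto simp: hd_conv_nth last_conv_nth)
  have nth1: "vs ! i = vs1 ! i" if "i \<le> length bs1" for i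
    using that len by (simp add: eq nth_append)
  \<comment> \<open>\<open>walk_concat\<close> drops vertex 0 of the second walk; the last vertex of
    the first one stands in for it.\<close>
  have nth2: "vs ! (length bs1 + i) = vs2 ! i" if "i \<le> length bs2" for i
  proof (cases i)
    case 0
    thus ?thesis using nth1[of "length bs1"] ends1 by simp
  next
    case (Suc j)
    thus ?thesis using that len by (simp add: eq nth_append nth_tl)
  qed
  have "is_walk G (vs, bs)"
  proof -
    have "ends G (bs ! i) = {vs ! i, vs ! (i + 1)}" if i: "i < length bs" for i
    proof (cases "i < length bs1")
      case True
      thus ?thesis using u(1) nth1[of i] nth1[of "i + 1"] by (simp add: eq(2) nth_append)
    next
      case False
      then obtain j where j: "i = length bs1 + j" by (metis le_add_diff_inverse not_le)
      hence "j < length bs2" using i by (simp add: eq)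
      thus ?thesis using u(2) nth2[of j] nth2[of "Suc j"] by (simp add: j eq(2) nth_append)
    qed
    moreover have "set (tl vs2) \<subseteq> verts G" using u(2) ne by (cases vs2) auto
    ultimately show ?thesis using u len by (auto simp: eq)
  qed
  moreover have "vs ! i = v \<longleftrightarrow> i = length bs1" if "0 < i" "i < length bs" for i
  proof (cases "i \<le> length bs1")
    case True
    thus ?thesis using u(1) that nth1[of i] ends1 by (cases "i = length bs1") auto
  next
    case False
    then obtain j where j: "i = length bs1 + j" by (metis le_add_diff_inverse nat_le_linear)
    hence "0 < j" "j < length bs2" using False that by (auto simp: eq)
    thus ?thesis using u(2) nth2[of j] by (auto simp: j)
  qed
  ultimately show ?R
    using u ends1 nth1[of 0] nth2[of "length bs2"] by (auto simp: eq(2) intro!: exI[of _ "length bs1"])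
next
  assume ?R
  then obtain k where w: "is_walk G (vs, bs)" "vs ! 0 = v" "vs ! length bs = v"
    and k: "0 < k" "k < length bs" "\<And>i. 0 < i \<Longrightarrow> i < length bs \<Longrightarrow> vs ! i = v \<longleftrightarrow> i = k"
    by blast
  have len: "length vs = Suc (length bs)" using w by simp
  have "hd (take (Suc k) vs) = v" "last (take (Suc k) vs) = v"
    using w(2) k len by (simp_all add: hd_conv_nth last_conv_nth flip: length_greater_0_conv)
  hence "f_walk G v (take (Suc k) vs, take k bs)"
    using w(1) k len by (auto dest: in_set_takeD)
  moreover have "f_walk G v (drop k vs, drop k bs)"
    using w k len by (auto simp: hd_drop_conv_nth last_conv_nth dest: in_set_dropD)
  moreover have "(vs, bs) = walk_concat (take (Suc k) vs, take k bs) (drop k vs, drop k bs)"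
    by (simp add: tl_drop drop_Suc[symmetric])
  ultimately show ?L by blast
qed

text \<open>With only two colours available, alternation propagates the first colour to every index
  by parity.\<close>

lemma alternating_iff:
  assumes "\<And>b. c b = 1 \<or> c b = 2"
  shows "alternating c (vs, bs) \<and> begins_with_colour c 1 (vs, bs) \<longleftrightarrow>
    bs \<noteq> [] \<and> (\<forall>i<length bs. c (bs ! i) = (if even i then 1 else 2))"
proof -
  have "c (bs ! i) = (if even i then 1 else 2)"
    if "alternating c (vs, bs)" "bs \<noteq> []" "c (hd bs) = 1" "i < length bs" for i
    using that(4)
  proof (induction i)
    case 0
    thus ?case using that by (simp add: hd_conv_nth)
  next
    case (Suc i)
    have "c (bs ! i) \<noteq> c (bs ! Suc i)" using that(1) Suc.prems by simp
    moreover have "c (bs ! i) = (if even i then 1 else 2)" using Suc by simp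
    ultimately show ?case using assms[of "bs ! Suc i"] by (cases "even i") auto
  qed
  moreover have "alternating c (vs, bs)" "c (hd bs) = 1"
    if "bs \<noteq> []" and col: "\<And>i. i < length bs \<Longrightarrow> c (bs ! i) = (if even i then 1 else 2)"
  proof -
    have "c (bs ! i) \<noteq> c (bs ! Suc i)" if "Suc i < length bs" for i
      using col[of i] col[of "Suc i"] that by simp
    thus "alternating c (vs, bs)" by simp
    show "c (hd bs) = 1" using col[of 0] \<open>bs \<noteq> []\<close> by (simp add: hd_conv_nth)
  qed
  ultimately show ?thesis unfolding begins_with_colour.simps by blast
qed

text \<open>\<open>Base\<close> edges have both ends at height \<open>e2\<close>,
  \<open>Extra\<close> loops sit only at other heights, and a \<open>Copy\<close> edge has both ends
  in one copy.\<close>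

lemma comb_loop_product_step:
  assumes "b \<in> edges (comb_loop_product G1 G2 e2)"
    and "ends (comb_loop_product G1 G2 e2) b = {(x, y), (x', y')}"
  shows "natural_colour b = 1 \<Longrightarrow> if y = e2 then y' = e2 else x' = x \<and> y' = y"
    and "natural_colour b = 2 \<Longrightarrow> x' = x"
proof -
  have ends: "comb_ends G1 G2 e2 b = {(x, y), (x', y')}"
    using assms(2) by (simp add: comb_loop_product_def comb_product_def)
  show "if y = e2 then y' = e2 else x' = x \<and> y' = y" if "natural_colour b = 1"
  proof (cases b)
    case (Base a)
    hence "(x, y) \<in> (\<lambda>x. (x, e2)) ` ends G1 a" "(x', y') \<in> (\<lambda>x. (x, e2)) ` ends G1 a"
      using ends by simp_all
    thus ?thesis by auto
  next
    case (Extra u v)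
    moreover from this have "v \<noteq> e2"
      using assms(1) by (auto simp: comb_loop_product_def comb_product_def)
    ultimately show ?thesis using ends by auto
  qed (use that in simp)
  show "x' = x" if "natural_colour b = 2"
  proof (cases b)
    case (Copy z a)
    hence "(x, y) \<in> Pair z ` ends G2 a" "(x', y') \<in> Pair z ` ends G2 a"
      using ends by simp_all
    thus ?thesis by auto
  qed (use that in simp_all)
qed

text \<open>
  The only edges leaving the copy of the second graph at \<open>e1\<close> are base edges, so a walk that avoids
  the root at even times visits it exactly once before each stay in that copy, namely on entering.
\<close>

lemma odd_root_visits:
  fixes G1 :: "('v1, 'e1) mgraph" and G2 :: "('v2, 'e2) mgraph" and e2 :: 'v2
  defines "G \<equiv> comb_loop_product G1 G2 e2"
  assumes edge: "\<And>i. i < 2 * k \<Longrightarrow> bs ! i \<in> edges G \<and> ends G (bs ! i) = {vs ! i, vs ! Suc i} \<and>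
      natural_colour (bs ! i) = (if even i then 1 else 2)"
    and start: "vs ! 0 = (e1, e2)"
    and avoid: "\<And>j. 0 < j \<Longrightarrow> j < k \<Longrightarrow> vs ! (2 * j) \<noteq> (e1, e2)"
  shows "if 0 < k \<and> fst (vs ! (2 * k)) = e1
    then \<exists>i. {i. i < 2 * k \<and> odd i \<and> vs ! i = (e1, e2)} = {i}
    else {i. i < 2 * k \<and> odd i \<and> vs ! i = (e1, e2)} = {}"
  using edge avoid
proof (induction k)
  case 0
  show ?case by simp
next
  case (Suc k)
  define S where "S k = {i. i < 2 * k \<and> odd i \<and> vs ! i = (e1, e2)}" for k
  have IH: "if 0 < k \<and> fst (vs ! (2 * k)) = e1 then \<exists>i. S k = {i} else S k = {}"
    unfolding S_def by (rule Suc.IH) (use Suc.prems in auto)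
  have S_Suc: "S (Suc k) = S k \<union> (if vs ! Suc (2 * k) = (e1, e2) then {Suc (2 * k)} else {})"
    by (auto simp: S_def less_Suc_eq)
  obtain x y x' y' x'' y'' where v: "vs ! (2 * k) = (x, y)" "vs ! Suc (2 * k) = (x', y')"
    "vs ! Suc (Suc (2 * k)) = (x'', y'')" by (meson surj_pair)
  have edges: "bs ! (2 * k) \<in> edges G" "ends G (bs ! (2 * k)) = {(x, y), (x', y')}"
    "natural_colour (bs ! (2 * k)) = 1" "bs ! Suc (2 * k) \<in> edges G"
    "ends G (bs ! Suc (2 * k)) = {(x', y'), (x'', y'')}" "natural_colour (bs ! Suc (2 * k)) = 2"
    using Suc.prems(1)[of "2 * k"] Suc.prems(1)[of "Suc (2 * k)"] by (simp_all add: v)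
  have red: "if y = e2 then y' = e2 else x' = x \<and> y' = y"
    by (rule comb_loop_product_step(1)[OF edges(1-3)[unfolded G_def]])
  have blue: "x'' = x'"
    by (rule comb_loop_product_step(2)[OF edges(4-6)[unfolded G_def]])
  have root: "if k = 0 then x = e1 \<and> y = e2 else (x, y) \<noteq> (e1, e2)"
    using start Suc.prems(2)[of k] v by auto
  \<comment> \<open>If \<open>y = e2\<close>, then \<open>k = 0\<close> or \<open>x\<close> differs
    from \<open>e1\<close>, so \<open>S k\<close> is empty and a base step into \<open>e1\<close>
    adds the one visit. Otherwise the colour 1 step is a loop, and neither the copy nor the set of
    visits changes.\<close>
  have "if x'' = e1 then \<exists>i. S (Suc k) = {i} else S (Suc k) = {}"
    using IH red blue root unfolding S_Suc v fst_conv
    by (cases "k = 0"; cases "y = e2"; cases "x' = e1") simp_all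
  thus ?case unfolding S_def by (simp only: v fst_conv mult_Suc_right add_2_eq_Suc zero_less_Suc simp_thms)
qed

text \<open>For these closed walks a single inner visit of the root amounts to no inner visit at
  even times: \<open>odd_root_visits\<close> supplies exactly one odd visit once even ones are
  excluded.\<close>

lemma D_walks_eq_alt_walks:
  fixes G1 :: "('v1, 'e1) mgraph" and G2 :: "('v2, 'e2) mgraph" and e2 :: 'v2
  defines "G \<equiv> comb_loop_product G1 G2 e2"
  assumes "0 < n"
  shows "D_walks G natural_colour (e1, e2) (2 * n) =
    alt_walks G natural_colour (e1, e2) (2 * n) (e1, e2)"
proof -
  let ?e = "(e1, e2)"
  let ?col = "\<lambda>bs. \<forall>i<2 * n. natural_colour (bs ! i) = (if even i then 1 else 2)"
  have colours: "natural_colour b = 1 \<or> natural_colour b = 2"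
    for b :: "('v1, 'e1, 'v2, 'e2) comb_edge"
    by (cases b) auto
  have "(vs, bs) \<in> D_walks G natural_colour ?e (2 * n) \<longleftrightarrow>
      (vs, bs) \<in> alt_walks G natural_colour ?e (2 * n) ?e" (is "?D \<longleftrightarrow> ?A") for vs bs
  proof -
    let ?W = "length bs = 2 * n \<and> is_walk G (vs, bs) \<and> vs ! 0 = ?e \<and> vs ! (2 * n) = ?e \<and> ?col bs"
    let ?once = "\<exists>k. 0 < k \<and> k < 2 * n \<and> (\<forall>i. 0 < i \<and> i < 2 * n \<longrightarrow> (vs ! i = ?e \<longleftrightarrow> i = k))"
    let ?avoid = "\<forall>i<2 * n. 0 < i \<and> even i \<longrightarrow> vs ! i \<noteq> ?e"
    have D: "?D \<longleftrightarrow> ?W \<and> ?once"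
    proof -
      have "?D \<longleftrightarrow> (alternating natural_colour (vs, bs) \<and> begins_with_colour natural_colour 1 (vs, bs)) \<and>
          (\<exists>u1 u2. f_walk G ?e u1 \<and> f_walk G ?e u2 \<and> (vs, bs) = walk_concat u1 u2) \<and>
          length bs = 2 * n"
        by (simp only: D_walks_def alternating_d_walk_def mem_Collect_eq walk_length.simps conj_assoc)
      thus ?thesis
        unfolding alternating_iff[OF colours] f_walk_concat_iff using assms(2) by auto
    qed
    have A: "?A \<longleftrightarrow> ?W \<and> ?avoid"
      by (auto simp: alt_walks_def)
    have "?once \<longleftrightarrow> ?avoid" if W: ?W
    proof -
      have edge: "bs ! i \<in> edges G \<and> ends G (bs ! i) = {vs ! i, vs ! Suc i} \<and>
          natural_colour (bs ! i) = (if even i then 1 else 2)" if "i < 2 * n" for i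
        using W that nth_mem[of i bs] by (auto simp: subset_iff)
      have visits: "if 0 < k \<and> fst (vs ! (2 * k)) = e1
          then \<exists>i. {i. i < 2 * k \<and> odd i \<and> vs ! i = ?e} = {i}
          else {i. i < 2 * k \<and> odd i \<and> vs ! i = ?e} = {}"
        if "k \<le> n" "\<And>j. 0 < j \<Longrightarrow> j < k \<Longrightarrow> vs ! (2 * j) \<noteq> ?e" for k
        by (rule odd_root_visits[of k bs G1 G2 e2]) (use edge W that in \<open>auto simp: G_def\<close>)
      show ?thesis
      proof
        assume ?once
        then obtain k where k: "0 < k" "k < 2 * n"
          "\<And>i. 0 < i \<Longrightarrow> i < 2 * n \<Longrightarrow> vs ! i = ?e \<longleftrightarrow> i = k" by blast
        have "odd k"
        proof
          \<comment> \<open>A first even visit at \<open>k\<close> forces an odd visit before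
            \<open>k\<close>, contrary to uniqueness.\<close>
          assume "even k"
          then obtain j where j: "k = 2 * j" by blast
          have "vs ! (2 * i) \<noteq> ?e" if "0 < i" "i < j" for i
            using k(3)[of "2 * i"] k(2) that j by simp
          moreover have "vs ! (2 * j) = ?e" using k(3)[of k] k(1,2) j by simp
          ultimately have "\<exists>i. {i. i < 2 * j \<and> odd i \<and> vs ! i = ?e} = {i}"
            using visits[of j] k(1,2) j by simp
          then obtain i where "i < k" "odd i" "vs ! i = ?e" using j by blast
          thus False using k by (metis less_imp_neq less_trans odd_pos)
        qed
        thus ?avoid using k by blast
      next
        assume avoid: ?avoid
        hence "\<exists>i. {i. i < 2 * n \<and> odd i \<and> vs ! i = ?e} = {i}"
          using visits[of n] W assms(2) by simp
        then obtain k where k: "{i. i < 2 * n \<and> odd i \<and> vs ! i = ?e} = {k}" by blast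
        hence "k < 2 * n" "odd k" by blast+
        moreover have "vs ! i = ?e \<longleftrightarrow> i = k" if "0 < i" "i < 2 * n" for i
          using k avoid that by blast
        ultimately show ?once by (metis odd_pos)
      qed
    qed
    thus ?thesis using D A by blast
  qed
  thus ?thesis by auto
qed

section \<open>Monotone independence\<close>

definition supported_on :: "'v set \<Rightarrow> ('v \<Rightarrow> complex) \<Rightarrow> bool" where
  "supported_on V f \<longleftrightarrow> (\<forall>v. v \<notin> V \<longrightarrow> f v = 0)"

definition homogeneous :: "'v opr \<Rightarrow> bool" where
  "homogeneous T \<longleftrightarrow> (\<forall>c f. T (\<lambda>v. c * f v) = (\<lambda>v. c * T f v))"

text \<open>Invariance keeps intermediate vectors within reach of \<open>column_opr\<close>, which
  speaks of supported functions only; homogeneity moves the scalar of a state past the remaining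
  operators.\<close>

definition stable_opr :: "'v set \<Rightarrow> 'v opr \<Rightarrow> bool" where
  "stable_opr V T \<longleftrightarrow> homogeneous T \<and> (\<forall>f. supported_on V f \<longrightarrow> supported_on V (T f))"

lemma nonunital_alg_stable:
  assumes "a \<in> nonunital_alg S" and "\<And>a. a \<in> S \<Longrightarrow> stable_opr V a"
  shows "stable_opr V a"
  using assms(1)
proof induction
  case (mult a b)
  thus ?case by (simp add: stable_opr_def homogeneous_def)
qed (use assms(2) in \<open>auto simp: stable_opr_def homogeneous_def supported_on_def
      opr_scale_def algebra_simps fun_eq_iff\<close>)

text \<open>
  Elements of the algebra of \<open>R\<^sub>1 - 1\<close> have the form \<open>a \<otimes> P\<close> with \<open>P\<close> the projection onto \<open>\<delta>(e2)\<close>,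
  elements of the algebra of \<open>R\<^sub>2 - 1\<close> have the form \<open>1 \<otimes> b\<close>. The next two predicates express this
  without tensor products.
\<close>

definition column_opr :: "('v1 \<times> 'v2) set \<Rightarrow> 'v2 \<Rightarrow> ('v1 \<times> 'v2) opr \<Rightarrow> bool" where
  "column_opr V e2 T \<longleftrightarrow>
     (\<forall>f g. supported_on V f \<and> supported_on V g \<and> (\<forall>x. f (x, e2) = g (x, e2)) \<longrightarrow> T f = T g) \<and>
     (\<forall>f x y. supported_on V f \<and> y \<noteq> e2 \<longrightarrow> T f (x, y) = 0)"

definition fibre_opr :: "'v1 set \<Rightarrow> ('v1 \<times> 'v2) opr \<Rightarrow> bool" where
  "fibre_opr V1 T \<longleftrightarrow>
     (\<exists>B. homogeneous B \<and> (\<forall>x\<in>V1. \<forall>f y. T f (x, y) = B (\<lambda>y. f (x, y)) y))"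

lemma nonunital_alg_column:
  assumes "a \<in> nonunital_alg {T}" "stable_opr V T" "column_opr V e2 T"
  shows "column_opr V e2 a"
  using assms(1)
proof induction
  case (gen a)
  thus ?case using assms(3) by simp
next
  case (add a b)
  thus ?case unfolding column_opr_def by (auto simp: plus_fun_apply) metis
next
  case (scale a c)
  thus ?case unfolding column_opr_def opr_scale_def by auto metis
next
  case (mult a b)
  have "stable_opr V b" using nonunital_alg_stable[OF mult.hyps(2)] assms(2) by blast
  thus ?case using mult.IH unfolding column_opr_def stable_opr_def o_apply by metis
qed

lemma nonunital_alg_fibre:
  assumes "b \<in> nonunital_alg {T}" "fibre_opr V1 T"
  shows "fibre_opr V1 b"
  using assms(1)
proof induction
  case (gen a)
  thus ?case using assms(2) by simp
next
  case (add a b)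
  then obtain A B where *: "homogeneous A" "homogeneous B"
    "\<And>x f y. x \<in> V1 \<Longrightarrow> a f (x, y) = A (\<lambda>y. f (x, y)) y"
    "\<And>x f y. x \<in> V1 \<Longrightarrow> b f (x, y) = B (\<lambda>y. f (x, y)) y"
    unfolding fibre_opr_def by metis
  show ?case unfolding fibre_opr_def
    by (rule exI[of _ "A + B"]) (use * in \<open>auto simp: homogeneous_def algebra_simps fun_eq_iff\<close>)
next
  case (scale a c)
  then obtain A where *: "homogeneous A"
    "\<And>x f y. x \<in> V1 \<Longrightarrow> a f (x, y) = A (\<lambda>y. f (x, y)) y"
    unfolding fibre_opr_def by metis
  show ?case unfolding fibre_opr_def
    by (rule exI[of _ "opr_scale c A"]) (use * in \<open>auto simp: opr_scale_def homogeneous_def fun_eq_iff\<close>)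
next
  case (mult a b)
  then obtain A B where *: "homogeneous A" "homogeneous B"
    "\<And>x f y. x \<in> V1 \<Longrightarrow> a f (x, y) = A (\<lambda>y. f (x, y)) y"
    "\<And>x f y. x \<in> V1 \<Longrightarrow> b f (x, y) = B (\<lambda>y. f (x, y)) y"
    unfolding fibre_opr_def by metis
  show ?case unfolding fibre_opr_def
    by (rule exI[of _ "A \<circ> B"]) (use * in \<open>auto simp: homogeneous_def\<close>)
qed

section \<open>Absorption of fibre operators by column operators\<close>

text \<open>Here \<open>f\<close> is a tensor g (x) delta(e2), which 1 (x) B sends to g (x) B
  delta(e2). Its part at height \<open>e2\<close> is a scalar multiple of \<open>f\<close>, and
  \<open>a\<close> sees only that part.\<close>

lemma column_fibre_absorb:
  fixes V1 :: "'v1 set" and V2 :: "'v2 set"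
  assumes a: "stable_opr (V1 \<times> V2) a" "column_opr (V1 \<times> V2) e2 a"
    and b: "stable_opr (V1 \<times> V2) b" "fibre_opr V1 b"
    and e: "e1 \<in> V1" "e2 \<in> V2"
    and f: "supported_on (V1 \<times> V2) f" "\<And>x y. y \<noteq> e2 \<Longrightarrow> f (x, y) = 0"
  shows "b f (x, e2) = b (delta (e1, e2)) (e1, e2) * f (x, e2)"
    and "a (b f) = (\<lambda>v. b (delta (e1, e2)) (e1, e2) * a f v)"
proof -
  obtain B where B: "homogeneous B" "\<And>x f y. x \<in> V1 \<Longrightarrow> b f (x, y) = B (\<lambda>y. f (x, y)) y"
    using b(2) unfolding fibre_opr_def by metis
  define \<beta> where "\<beta> = b (delta (e1, e2)) (e1, e2)"
  \<comment> \<open>All fibres carry the same \<open>B\<close>, so the scalar can be read off over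
    \<open>e1\<close>.\<close>
  have \<beta>: "\<beta> = B (delta e2) e2"
    unfolding \<beta>_def B(2)[OF e(1)] by (simp add: delta_def)
  have root: "b f (x, e2) = \<beta> * f (x, e2)" for x
  proof (cases "x \<in> V1")
    case True
    have "(\<lambda>y. f (x, y)) = (\<lambda>y. f (x, e2) * delta e2 y)"
      using f(2) by (auto simp: delta_def)
    thus ?thesis using B(1) by (simp add: B(2)[OF True] homogeneous_def \<beta>)
  next
    case False
    thus ?thesis using b(1) f(1) by (simp add: stable_opr_def supported_on_def)
  qed
  thus "b f (x, e2) = b (delta (e1, e2)) (e1, e2) * f (x, e2)" by (simp add: \<beta>_def)
  have "supported_on (V1 \<times> V2) (b f)" "supported_on (V1 \<times> V2) (\<lambda>v. \<beta> * f v)"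
    using b(1) f(1) by (simp_all add: stable_opr_def supported_on_def)
  hence "a (b f) = a (\<lambda>v. \<beta> * f v)"
    using a(2) root unfolding column_opr_def by blast
  thus "a (b f) = (\<lambda>v. b (delta (e1, e2)) (e1, e2) * a f v)"
    using a(1) by (simp add: stable_opr_def homogeneous_def \<beta>_def)
qed

text \<open>Absorption is applied to \<open>delta (e1, e2)\<close> for the first identity and to the
  vector produced by \<open>a2\<close> and \<open>w2\<close> for the other two.\<close>

lemma monotone_independent_column_fibre:
  fixes V1 :: "'v1 set" and V2 :: "'v2 set"
  assumes e: "e1 \<in> V1" "e2 \<in> V2"
    and S: "stable_opr (V1 \<times> V2) S" "column_opr (V1 \<times> V2) e2 S"
    and T: "stable_opr (V1 \<times> V2) T" "fibre_opr V1 T"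
  shows "monotone_independent (vec_state (V1 \<times> V2) (e1, e2)) S T"
proof -
  let ?V = "V1 \<times> V2" and ?e = "(e1, e2)"
  let ?\<phi> = "vec_state ?V ?e"
  have \<phi>: "?\<phi> U = U (delta ?e) ?e" for U
    using e by (intro vec_state_eq) simp
  have \<delta>_supp: "supported_on ?V (delta ?e)"
    using e by (auto simp: supported_on_def delta_def)
  have main: "?\<phi> (w1 \<circ> a1 \<circ> b) = ?\<phi> b * ?\<phi> (w1 \<circ> a1) \<and>
      ?\<phi> (b \<circ> a2 \<circ> w2) = ?\<phi> b * ?\<phi> (a2 \<circ> w2) \<and>
      ?\<phi> (w1 \<circ> a1 \<circ> b \<circ> a2 \<circ> w2) = ?\<phi> b * ?\<phi> (w1 \<circ> a1 \<circ> a2 \<circ> w2)"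
    if a1: "a1 \<in> nonunital_alg {S}" and a2: "a2 \<in> nonunital_alg {S}"
      and b: "b \<in> nonunital_alg {T}"
      and w1: "w1 \<in> unital_alg (nonunital_alg {S} \<union> nonunital_alg {T})"
      and w2: "w2 \<in> unital_alg (nonunital_alg {S} \<union> nonunital_alg {T})"
    for a1 a2 b w1 w2
  proof -
    have gens: "stable_opr ?V u" if "u \<in> nonunital_alg {S} \<union> nonunital_alg {T}" for u
      using that nonunital_alg_stable[of u] S(1) T(1) by blast
    have stable_w: "stable_opr ?V w"
      if "w \<in> unital_alg (nonunital_alg {S} \<union> nonunital_alg {T})" for w
      using that unfolding unital_alg_def
    proof (rule nonunital_alg_stable)
      fix u :: "('v1 \<times> 'v2) opr"
      assume "u \<in> insert id (nonunital_alg {S} \<union> nonunital_alg {T})"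
      thus "stable_opr ?V u"
        using gens by (auto simp: stable_opr_def homogeneous_def)
    qed
    have stable_a: "stable_opr ?V a1" "stable_opr ?V a2" "stable_opr ?V b"
      using gens a1 a2 b by auto
    have column: "column_opr ?V e2 a1" "column_opr ?V e2 a2" and fibre: "fibre_opr V1 b"
      using nonunital_alg_column[OF _ S] nonunital_alg_fibre[OF _ T(2)] a1 a2 b by auto
    note absorb = column_fibre_absorb[OF stable_a(1) column(1) stable_a(3) fibre e]
    define g where "g = a2 (w2 (delta ?e))"
    have w2\<delta>: "supported_on ?V (w2 (delta ?e))"
      using stable_w[OF w2] \<delta>_supp by (simp add: stable_opr_def)
    have g: "supported_on ?V g" "\<And>x y. y \<noteq> e2 \<Longrightarrow> g (x, y) = 0"
      using stable_a(2) column(2) w2\<delta> by (auto simp: g_def stable_opr_def column_opr_def)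
    have w1_scale: "w1 (\<lambda>v. c * f v) = (\<lambda>v. c * w1 f v)" for c f
      using stable_w[OF w1] by (simp add: stable_opr_def homogeneous_def)
    have "a1 (b (delta ?e)) = (\<lambda>v. ?\<phi> b * a1 (delta ?e) v)"
      unfolding \<phi> by (rule absorb(2)) (use e in \<open>auto simp: supported_on_def delta_def\<close>)
    moreover have "a1 (b g) = (\<lambda>v. ?\<phi> b * a1 g v)"
      unfolding \<phi> by (rule absorb(2)[OF g])
    moreover have "b g ?e = ?\<phi> b * g ?e"
      unfolding \<phi> by (rule absorb(1)[OF g])
    ultimately show ?thesis
      by (simp add: \<phi>[of "_ \<circ> _"] w1_scale flip: g_def)
  qed
  show ?thesis unfolding monotone_independent_def Let_def using main by blast
qed

lemma stable_opr_adjacency_minus_id: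
  assumes "wf_mgraph H"
  shows "stable_opr (verts H) (adjacency H - id)"
  using assms nbrs_outside[OF assms]
  by (auto simp: stable_opr_def homogeneous_def supported_on_def adjacency_def sum_distrib_left
      algebra_simps fun_eq_iff)

section \<open>The coloured comb loop product\<close>

context
  fixes G1 :: "('v1, 'e1) mgraph" and G2 :: "('v2, 'e2) mgraph" and e1 :: 'v1 and e2 :: 'v2
  assumes rooted1: "rooted_graph G1 e1" and rooted2: "rooted_graph G2 e2"
begin

abbreviation (input) loop_product where "loop_product \<equiv> comb_loop_product G1 G2 e2"
definition red where "red = colour_subgraph loop_product natural_colour 1"
definition blue where "blue = colour_subgraph loop_product natural_colour 2"

lemma verts_loop_product: "verts loop_product = verts G1 \<times> verts G2"
  by (simp add: comb_loop_product_def comb_product_def)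

lemma roots: "e1 \<in> verts G1" "e2 \<in> verts G2"
  using rooted1 rooted2 by (auto simp: rooted_graph_def)

lemma wf_parts: "wf_mgraph G1" "wf_mgraph G2" "wf_mgraph loop_product"
  using rooted1 rooted2 wf_comb_loop_product[of G1 G2 e2] by (auto simp: rooted_graph_def)

lemma edges_red:
  "Base b \<in> edges red \<longleftrightarrow> b \<in> edges G1" "Copy x b' \<notin> edges red"
  "Extra x y \<in> edges red \<longleftrightarrow> x \<in> verts G1 \<and> y \<in> verts G2 \<and> y \<noteq> e2"
  by (simp_all add: red_def blue_def colour_subgraph_def comb_loop_product_def comb_product_def)

lemma edges_blue:
  "Base b \<notin> edges blue" "Copy x b' \<in> edges blue \<longleftrightarrow> x \<in> verts G1 \<and> b' \<in> edges G2"
  "Extra x y \<notin> edges blue"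
  by (simp_all add: red_def blue_def colour_subgraph_def comb_loop_product_def comb_product_def)

lemma verts_colour:
  "verts red = verts G1 \<times> verts G2" "verts blue = verts G1 \<times> verts G2"
  by (simp_all add: red_def blue_def colour_subgraph_def comb_loop_product_def comb_product_def)

lemma ends_colour: "ends red = comb_ends G1 G2 e2" "ends blue = comb_ends G1 G2 e2"
  by (simp_all add: red_def blue_def colour_subgraph_def comb_loop_product_def comb_product_def)

lemma wf_colour: "wf_mgraph red" "wf_mgraph blue"
  by (simp_all add: red_def blue_def wf_colour_subgraph wf_parts)

section \<open>Tensor form of the two colour operators\<close>

lemma ends_Base_iff:
  "comb_ends G1 G2 e2 (Base b) = {(x, y), (x', y')} \<longleftrightarrow> ends G1 b = {x, x'} \<and> y = e2 \<and> y' = e2"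
proof -
  have "y = e2 \<and> y' = e2" if "(\<lambda>x. (x, e2)) ` ends G1 b = {(x, y), (x', y')}"
    using that by blast
  moreover have "(\<lambda>x. (x, e2)) ` ends G1 b = (\<lambda>x. (x, e2)) ` {x, x'} \<longleftrightarrow> ends G1 b = {x, x'}"
    by (rule inj_image_eq_iff) (simp add: inj_def)
  ultimately show ?thesis by auto
qed

lemma ends_Copy_iff:
  "comb_ends G1 G2 e2 (Copy z b) = {(x, y), (x', y')} \<longleftrightarrow> ends G2 b = {y, y'} \<and> x = z \<and> x' = z"
proof -
  have "x = z \<and> x' = z" if "Pair z ` ends G2 b = {(x, y), (x', y')}"
    using that by blast
  moreover have "Pair z ` ends G2 b = Pair z ` {y, y'} \<longleftrightarrow> ends G2 b = {y, y'}"
    by (rule inj_image_eq_iff) (simp add: inj_def)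
  ultimately show ?thesis by auto
qed

text \<open>In this form one computation of the set of joining edges yields both \<open>nbrs\<close>
  and \<open>n_edges\<close>.\<close>

lemma nbrs_iff: "x' \<in> nbrs H x \<longleftrightarrow> x' \<in> verts H \<and> {b \<in> edges H. ends H b = {x, x'}} \<noteq> {}"
  by (auto simp: nbrs_def)

text \<open>The summand A1 (x) P: no extra loop sits at height \<open>e2\<close>, and base edges
  stay at that height.\<close>

lemma adj_red_root: "adj red f (x, e2) = adj G1 (\<lambda>x. f (x, e2)) x"
proof -
  have joins: "{b \<in> edges red. ends red b = {(x, e2), (x', y')}} =
      Base ` {b \<in> edges G1. y' = e2 \<and> ends G1 b = {x, x'}}" for x' y'
  proof (rule set_eqI)
    fix b show "b \<in> {b \<in> edges red. ends red b = {(x, e2), (x', y')}} \<longleftrightarrow>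
        b \<in> Base ` {b \<in> edges G1. y' = e2 \<and> ends G1 b = {x, x'}}"
      by (cases b) (auto simp: edges_red ends_colour ends_Base_iff simp del: comb_ends.simps(1))
  qed
  have "(x', y') \<in> nbrs red (x, e2) \<longleftrightarrow> x' \<in> nbrs G1 x \<and> y' = e2" for x' y'
    unfolding nbrs_iff joins using roots by (auto simp: verts_colour)
  hence nb: "nbrs red (x, e2) = (\<lambda>x'. (x', e2)) ` nbrs G1 x" by auto
  have n: "n_edges red (x, e2) (x', e2) = n_edges G1 x x'" for x'
    unfolding n_edges_def joins by (simp add: card_image inj_on_def)
  show ?thesis unfolding adj_def nb by (subst sum.reindex) (auto simp: inj_on_def n)
qed

text \<open>The summand 1 (x) (1 - P): the only colour 1 edge at such a vertex is its extra
  loop.\<close>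

lemma adj_red_nonroot:
  assumes "x \<in> verts G1" "y \<in> verts G2" "y \<noteq> e2"
  shows "adj red f (x, y) = f (x, y)"
proof -
  have joins: "{b \<in> edges red. ends red b = {(x, y), v}} =
      (if v = (x, y) then {Extra x y} else {})" for v
  proof (rule set_eqI)
    fix b show "b \<in> {b \<in> edges red. ends red b = {(x, y), v}} \<longleftrightarrow>
        b \<in> (if v = (x, y) then {Extra x y} else {})"
      using assms
      by (cases b; cases v) (auto simp: edges_red ends_colour ends_Base_iff simp del: comb_ends.simps(1))
  qed
  have "v \<in> nbrs red (x, y) \<longleftrightarrow> v = (x, y)" for v
    unfolding nbrs_iff joins using assms by (auto simp: verts_colour)
  hence "nbrs red (x, y) = {(x, y)}" by auto
  moreover have "n_edges red (x, y) (x, y) = 1"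
    unfolding n_edges_def joins by simp
  ultimately show ?thesis by (simp add: adj_def)
qed

lemma adj_blue:
  assumes "x \<in> verts G1"
  shows "adj blue f (x, y) = adj G2 (\<lambda>y. f (x, y)) y"
proof -
  have joins: "{b \<in> edges blue. ends blue b = {(x, y), (x', y')}} =
      Copy x ` {b \<in> edges G2. x' = x \<and> ends G2 b = {y, y'}}" for x' y'
  proof (rule set_eqI)
    fix b show "b \<in> {b \<in> edges blue. ends blue b = {(x, y), (x', y')}} \<longleftrightarrow>
        b \<in> Copy x ` {b \<in> edges G2. x' = x \<and> ends G2 b = {y, y'}}"
      using assms
      by (cases b) (auto simp: edges_blue ends_colour ends_Copy_iff simp del: comb_ends.simps(2))
  qed
  have "(x', y') \<in> nbrs blue (x, y) \<longleftrightarrow> x' = x \<and> y' \<in> nbrs G2 y" for x' y'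
    unfolding nbrs_iff joins using assms by (auto simp: verts_colour)
  hence nb: "nbrs blue (x, y) = Pair x ` nbrs G2 y" by auto
  have n: "n_edges blue (x, y) (x, y') = n_edges G2 y y'" for y'
    unfolding n_edges_def joins by (simp add: card_image inj_on_def)
  show ?thesis unfolding adj_def nb by (subst sum.reindex) (auto simp: inj_on_def n)
qed

lemma adj_red_outside: "x \<notin> verts G1 \<or> y \<notin> verts G2 \<Longrightarrow> adj red f (x, y) = 0"
  by (intro adj_outside wf_colour) (auto simp: verts_colour)

lemma adj_blue_outside: "x \<notin> verts G1 \<Longrightarrow> adj blue f (x, y) = 0"
  by (intro adj_outside wf_colour) (auto simp: verts_colour)

text \<open>
  Between two visits to the base, the colour \<open>1\<close> steps are loops and the colour \<open>2\<close> steps perform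
  an excursion in one copy of the second graph, which contributes the factor \<open>\<eta>\<^sub>2(z)\<close> to every
  base step. Hence the generating vector \<open>F\<close> of the first-passage vectors of \<open>R\<^sub>2 R\<^sub>1\<close> is obtained
  from those of the factors by substituting \<open>\<eta>\<^sub>2\<close> for the variable of the first one.
\<close>

lemma eta_fps_loop_product:
  "eta_fps (opr_distr (vec_state (verts loop_product) (e1, e2)) (adjacency blue \<circ> adjacency red)) =
    fps_compose (eta_fps (spectral_distr G1 e1)) (eta_fps (spectral_distr G2 e2))"
proof -
  let ?Z = "adjacency blue \<circ> adjacency red"
  define h1 where "h1 x = Abs_fps (\<lambda>n. passage (adjacency G1) e1 n x)" for x
  define h2 where "h2 y = Abs_fps (\<lambda>n. passage (adjacency G2) e2 n y)" for y
  define \<eta>2 where "\<eta>2 = eta_fps (spectral_distr G2 e2)"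
  have \<eta>2_0: "fps_nth \<eta>2 0 = 0" by (simp add: \<eta>2_def eta_fps_nth_0)
  have h1: "h1 x = (if x = e1 then 1 else fps_X * adj G1 h1 x)" for x
    by (rule eta_fps_adjacency(1)) (simp_all add: roots h1_def)
  have eta1: "eta_fps (spectral_distr G1 e1) = fps_X * adj G1 h1 e1"
    by (rule eta_fps_adjacency(2)) (simp_all add: roots h1_def)
  have h2: "h2 y = (if y = e2 then 1 else fps_X * adj G2 h2 y)" for y
    by (rule eta_fps_adjacency(1)) (simp_all add: roots h2_def)
  have eta2: "\<eta>2 = fps_X * adj G2 h2 e2"
    unfolding \<eta>2_def by (rule eta_fps_adjacency(2)) (simp_all add: roots h2_def)
  define K where "K x = adj G1 h1 x oo \<eta>2" for x
  \<comment> \<open>Chosen so that colour 1 turns \<open>F\<close> into the product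
    \<open>K x * h2 y\<close>: at height \<open>e2\<close> the first graph acts on the substituted
    \<open>h1\<close>, elsewhere the loops leave \<open>F\<close> unchanged.\<close>
  define F where "F = (\<lambda>(x, y). if y = e2 then h1 x oo \<eta>2 else K x * h2 y)"
  have F_apply: "F (x, y) = (if y = e2 then h1 x oo \<eta>2 else K x * h2 y)" for x y
    by (simp add: F_def)
  have X_adj: "(fps_X * adj G1 h1 x) oo \<eta>2 = \<eta>2 * K x" for x
    by (simp add: K_def fps_compose_mult_distrib[OF \<eta>2_0] \<eta>2_0)
  have K_outside: "K x = 0" if "x \<notin> verts G1" for x
    using that by (simp add: K_def adj_outside wf_parts)
  have h2_outside: "h2 y = 0" if "y \<notin> verts G2" for y
    using that roots by (subst h2) (auto simp: adj_outside wf_parts)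
  have RF: "adj red F (x, y) = K x * h2 y" for x y
  proof (cases "y = e2")
    case True
    have "adj red F (x, e2) = adj G1 (\<lambda>x. h1 x oo \<eta>2) x"
      by (simp add: adj_red_root F_def)
    thus ?thesis using True by (simp add: adj_fps_compose[OF \<eta>2_0] K_def h2[of e2])
  next
    case False
    thus ?thesis
      by (cases "x \<in> verts G1 \<and> y \<in> verts G2")
        (auto simp: adj_red_nonroot adj_red_outside F_def K_outside h2_outside)
  qed
  have ZF: "adj blue (adj red F) (x, y) = K x * adj G2 h2 y" for x y
    by (cases "x \<in> verts G1") (simp_all add: adj_blue RF adj_mult_left adj_blue_outside K_outside)
  \<comment> \<open>At height \<open>e2\<close> off the root this is the system for
    \<open>h1\<close> after substitution, combined with \<open>eta2\<close>; at other heights it is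
    the system for \<open>h2\<close>.\<close>
  have F: "F v = (if v = (e1, e2) then 1 else fps_X * adj blue (adj red F) v)" for v
  proof (cases v)
    case (Pair x y)
    have "h1 x oo \<eta>2 = \<eta>2 * K x" if "x \<noteq> e1"
      using that X_adj by (subst h1) simp
    moreover have "h1 e1 oo \<eta>2 = 1" by (simp add: h1[of e1])
    moreover have "h2 y = fps_X * adj G2 h2 y" if "y \<noteq> e2"
      using that by (subst h2) simp
    ultimately show ?thesis
      by (auto simp: Pair ZF F_apply eta2 mult_ac)
  qed
  have nth: "fps_nth (adj blue (adj red F) v) n = ?Z (\<lambda>v. fps_nth (F v) n) v" for v n
    by (simp add: fps_nth_adj adjacency_eq_adj)
  \<comment> \<open>The factor \<open>fps_X\<close> lets the equation determine each coefficient
    from the preceding one, which is the passage recursion.\<close>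
  have F_nth: "(\<lambda>v. fps_nth (F v) n) = passage ?Z (e1, e2) n" for n
  proof (induction n)
    case 0
    show ?case by (rule ext, subst F) (simp add: passage_0 delta_def)
  next
    case (Suc n)
    show ?case by (rule ext, subst F) (simp add: passage_Suc nth Suc del: o_apply)
  qed
  have "eta_fps (opr_distr (vec_state (verts loop_product) (e1, e2)) ?Z) =
      fps_X * Abs_fps (\<lambda>n. ?Z (passage ?Z (e1, e2) n) (e1, e2))"
    by (intro eta_fps_eq_passage linear_opr_comp linear_opr_adjacency)
      (simp add: verts_loop_product roots)
  also have "Abs_fps (\<lambda>n. ?Z (passage ?Z (e1, e2) n) (e1, e2)) = adj blue (adj red F) (e1, e2)"
    by (rule fps_ext) (simp add: nth F_nth del: o_apply)
  also have "fps_X * \<dots> = \<eta>2 * K e1"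
    by (simp add: ZF eta2 mult_ac)
  also have "\<dots> = eta_fps (spectral_distr G1 e1) oo \<eta>2"
    by (simp add: eta1 X_adj)
  finally show ?thesis unfolding \<eta>2_def .
qed

lemma monotone_independent_loop_product:
  "monotone_independent (vec_state (verts G1 \<times> verts G2) (e1, e2))
    (adjacency red - id) (adjacency blue - id)"
proof (rule monotone_independent_column_fibre)
  let ?V = "verts G1 \<times> verts G2"
  let ?R1 = "adjacency red" and ?R2 = "adjacency blue"
  show "e1 \<in> verts G1" "e2 \<in> verts G2" using roots by auto
  show "stable_opr ?V (?R1 - id)" "stable_opr ?V (?R2 - id)"
    using stable_opr_adjacency_minus_id[OF wf_colour(1)]
      stable_opr_adjacency_minus_id[OF wf_colour(2)]
    by (simp_all add: verts_colour)
  \<comment> \<open>The extra loop contributes exactly the identity, which the subtraction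
    cancels.\<close>
  have nonroot: "(?R1 - id) f (x, y) = 0" if "supported_on ?V f" "y \<noteq> e2" for f x y
    using that
    by (cases "x \<in> verts G1 \<and> y \<in> verts G2")
      (auto simp: adjacency_eq_adj adj_red_nonroot adj_red_outside supported_on_def)
  have "(?R1 - id) f = (?R1 - id) g"
    if "supported_on ?V f" "supported_on ?V g" "\<And>x. f (x, e2) = g (x, e2)" for f g
  proof
    fix v show "(?R1 - id) f v = (?R1 - id) g v"
      using nonroot[of f] nonroot[of g] that
      by (cases v; cases "snd v = e2") (auto simp: adjacency_eq_adj adj_red_root)
  qed
  thus "column_opr ?V e2 (?R1 - id)"
    unfolding column_opr_def using nonroot by blast
  show "fibre_opr (verts G1) (?R2 - id)"
    unfolding fibre_opr_def
    \<comment> \<open>Every copy carries the same operator of the second graph.\<close>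
    by (rule exI[of _ "adjacency G2 - id"])
      (auto simp: homogeneous_def adjacency_eq_adj adj_blue adj_mult_left fun_eq_iff algebra_simps)
qed

end

theorem theorem3p1:
  fixes G1 :: "('v1, 'e1) mgraph" and e1 :: 'v1
    and G2 :: "('v2, 'e2) mgraph" and e2 :: 'v2
    and G :: "('v1 \<times> 'v2, ('v1, 'e1, 'v2, 'e2) comb_edge) mgraph" and e :: "'v1 \<times> 'v2"
    and R1 R2 Z :: "('v1 \<times> 'v2) opr"
    and \<mu>1 \<mu>2 :: "complex poly \<Rightarrow> complex"
    and \<phi> :: "('v1 \<times> 'v2) opr \<Rightarrow> complex"
  assumes "rooted_graph G1 e1" and "rooted_graph G2 e2"
    and "\<mu>1 = spectral_distr G1 e1" and "\<mu>2 = spectral_distr G2 e2"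
    and "G = comb_loop_product G1 G2 e2" and "e = (e1, e2)"
    and "R1 = adjacency (colour_subgraph G natural_colour 1)"
    and "R2 = adjacency (colour_subgraph G natural_colour 2)"
    and "Z = R2 \<circ> R1"
    and "\<phi> = vec_state (verts G) e"
  shows "(\<forall>n. N_coeff (opr_distr \<phi> Z) n = N_coeff (mono_mult_conv \<mu>1 \<mu>2) n \<and>
              finite (D_walks G natural_colour e (2 * n)) \<and>
              N_coeff (mono_mult_conv \<mu>1 \<mu>2) n =
                of_nat (card (D_walks G natural_colour e (2 * n))))
         \<and> monotone_independent \<phi> (R1 - id) (R2 - id)"
proof -
  note r = assms(1,2)
  have R: "R1 = adjacency (red G1 G2 e2)" "R2 = adjacency (blue G1 G2 e2)"
    by (simp_all add: assms(5,7,8) red_def[OF r] blue_def[OF r])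
  have wf: "wf_mgraph G" and ulf: "uniformly_locally_finite G"
    using r unfolding assms(5) rooted_graph_def
    by (simp_all add: wf_comb_loop_product uniformly_locally_finite_comb_loop_product)
  have e: "e \<in> verts G"
    using roots[OF r] verts_loop_product[OF r] by (simp add: assms(5,6))
  have eta: "eta_fps (opr_distr \<phi> Z) = eta_fps (mono_mult_conv \<mu>1 \<mu>2)"
    using eta_fps_loop_product[OF r] by (simp only: mono_mult_conv_char(2) R assms(3-6,9,10))
  have "finite (D_walks G natural_colour e (2 * n)) \<and>
      N_coeff (opr_distr \<phi> Z) n = of_nat (card (D_walks G natural_colour e (2 * n)))" for n
  proof (cases n)
    \<comment> \<open>Both sides vanish: eta has no constant term, and a d-walk must begin with an
      edge.\<close>
    case 0
    have "D_walks G natural_colour e 0 = {}"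
      by (auto simp: D_walks_def alternating_d_walk_def)
    thus ?thesis using 0 by (simp add: N_coeff_def eta_fps_nth_0)
  next
    case (Suc m)
    have D: "D_walks G natural_colour e (2 * n) = alt_walks G natural_colour e (2 * n) e"
      unfolding assms(5,6) by (rule D_walks_eq_alt_walks) (simp add: Suc)
    have "linear_opr Z"
      unfolding assms(7-9) by (intro linear_opr_comp linear_opr_adjacency)
    \<comment> \<open>The factor \<open>fps_X\<close> in the first-return series shifts the index
      from \<open>n\<close> to \<open>m\<close>.\<close>
    hence "N_coeff (opr_distr \<phi> Z) n = Z (passage Z e m) e"
      unfolding N_coeff_def assms(10) by (subst eta_fps_eq_passage[OF _ e]) (simp_all add: Suc)
    also have "\<dots> = of_nat (card (alt_walks G natural_colour e (2 * n) e))"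
      unfolding assms(7-9) Suc by (rule card_alt_walks_even[OF wf ulf e, symmetric])
    finally show ?thesis by (simp add: D finite_alt_walks[OF ulf e])
  qed
  moreover have "monotone_independent \<phi> (R1 - id) (R2 - id)"
    using monotone_independent_loop_product[OF r] verts_loop_product[OF r]
    by (simp only: R assms(5,6,10))
  ultimately show ?thesis by (simp add: N_coeff_def eta)
qed

end
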